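(* Let $\mathcal{Q}^{(l)}$ be the set of rooted labeled quadrangulations of the sphere (with at least one face) and $\mathcal{M}^{(l)}$ the set of rooted labeled planar maps (with at least one edge). The map $\Psi:\mathcal{Q}^{(l)}\to\mathcal{M}^{(l)}$ defined by Schaeffer's prescription is a bijection, and for every $Q\in\mathcal{Q}^{(l)}$: (i) the number of edges of $\Psi(Q)$ equals the number $N$ of faces of $Q$; (ii) the number of faces of $\Psi(Q)$ equals the number of local minima of the labeling of $Q$; (iii) the number of local maxima of the labeling of $\Psi(Q)$ equals the number of local maxima of the labeling of $Q$ (indeed the sets of local maxima coincide); (iv) the maximal label of $\Psi(Q)$ equals the maximal label of $Q$; (v) the minimal label of $\Psi(Q)$ equals the minimal label of $Q$ plus one; (vi) the label of the root vertex of $\Psi(Q)$ equals the larger of the two labels of the endpoints of the root edge of $Q$.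
   Context: A planar map is a connected multigraph (loops and multiple edges allowed) embedded in the oriented 2-sphere without edge crossings, considered up to orientation-preserving continuous deformation; faces, degrees and corners (sectors at a vertex between consecutive edges around a face) are as usual. A quadrangulation is a planar map all of whose faces have degree 4. $\mathcal{Q}^{(l)}$: quadrangulations with a marked unoriented edge (the root edge) and integer labels on the vertices such that labels differ by exactly one along every edge. $\mathcal{M}^{(l)}$: planar maps with a marked corner (the root corner; its vertex is the root vertex) and integer labels on the vertices such that labels differ by at most one along every edge. A local minimum (resp. maximum) of a labeling of a map is a vertex whose label is $\le$ (resp. $\ge$) the labels of all its neighbours. For $Q\in\mathcal{Q}^{(l)}$ each face has cyclic labels $(t-1,t,t+1,t)$ (simple) or $(t+1,t,t+1,t)$ (confluent). Schaeffer's prescription: inside each confluent face draw the diagonal joining its two corners labelled $t+1$; inside each simple face draw a new edge parallel to the side joining the corner labelled $t+1$ to the next corner of the face in clockwise order; discard the original edges, keep as vertices those incident to new edges, with their labels. $\Psi(Q)$ is the resulting labelled planar map, rooted at the corner of $\Psi(Q)$, at the endpoint $v$ of the root edge of $Q$ having the larger label, into which the root edge of $Q$ points. *)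

theory Defs
  imports Main
begin

section \<open>Combinatorial maps (rotation systems)\<close>

text \<open>A planar map is encoded as a combinatorial map on a finite set of darts D
(half-edges, here natural numbers): alpha is the fixed-point-free involution
pairing the two darts of an edge, sigma is the counterclockwise rotation of the
darts around their origin vertex (positive orientation of the sphere), and
phi = sigma o alpha traverses the faces (each face in clockwise order, the face
lying to the right).  Vertices, edges, faces are the orbits of sigma, alpha,
phi.  Planarity (genus 0) is Euler's formula V - E + F = 2 for a connected map.
Corners: the dart c represents the corner at the origin of c which is the sector
swept counterclockwise from the dart (sigma^-1 c) to c.  Labels are functions on
darts that are constant on vertices.\<close>

definition f_orbit :: "(nat \<Rightarrow> nat) \<Rightarrow> nat \<Rightarrow> nat set" where
  "f_orbit f d = range (\<lambda>n. (f ^^ n) d)"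

definition f_orbits :: "(nat \<Rightarrow> nat) \<Rightarrow> nat set \<Rightarrow> nat set set" where
  "f_orbits f D = f_orbit f ` D"

definition face_perm :: "(nat \<Rightarrow> nat) \<Rightarrow> (nat \<Rightarrow> nat) \<Rightarrow> nat \<Rightarrow> nat" where
  "face_perm \<alpha> \<sigma> = \<sigma> \<circ> \<alpha>"

definition n_vertices :: "nat set \<Rightarrow> (nat \<Rightarrow> nat) \<Rightarrow> (nat \<Rightarrow> nat) \<Rightarrow> nat" where
  "n_vertices D \<alpha> \<sigma> = card (f_orbits \<sigma> D)"

definition n_edges :: "nat set \<Rightarrow> (nat \<Rightarrow> nat) \<Rightarrow> (nat \<Rightarrow> nat) \<Rightarrow> nat" where
  "n_edges D \<alpha> \<sigma> = card (f_orbits \<alpha> D)"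

definition n_faces :: "nat set \<Rightarrow> (nat \<Rightarrow> nat) \<Rightarrow> (nat \<Rightarrow> nat) \<Rightarrow> nat" where
  "n_faces D \<alpha> \<sigma> = card (f_orbits (face_perm \<alpha> \<sigma>) D)"

definition is_planar_map :: "nat set \<Rightarrow> (nat \<Rightarrow> nat) \<Rightarrow> (nat \<Rightarrow> nat) \<Rightarrow> bool" where
  "is_planar_map D \<alpha> \<sigma> \<longleftrightarrow>
     finite D \<and> D \<noteq> {} \<and>
     (\<forall>d\<in>D. \<alpha> d \<in> D \<and> \<alpha> d \<noteq> d \<and> \<alpha> (\<alpha> d) = d) \<and>
     bij_betw \<sigma> D D \<and>
     (\<forall>x\<in>D. \<forall>y\<in>D. (x, y) \<in> ({(d, \<alpha> d) | d. d \<in> D} \<union> {(d, \<sigma> d) | d. d \<in> D})\<^sup>*) \<and>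
     int (n_vertices D \<alpha> \<sigma>) - int (n_edges D \<alpha> \<sigma>) + int (n_faces D \<alpha> \<sigma>) = 2"

definition is_quadrangulation :: "nat set \<Rightarrow> (nat \<Rightarrow> nat) \<Rightarrow> (nat \<Rightarrow> nat) \<Rightarrow> bool" where
  "is_quadrangulation D \<alpha> \<sigma> \<longleftrightarrow> is_planar_map D \<alpha> \<sigma> \<and>
     (\<forall>d\<in>D. card (f_orbit (face_perm \<alpha> \<sigma>) d) = 4)"

text \<open>Local minima / maxima of a labelling, as sets of vertices (sigma-orbits).
The neighbours of the vertex of a dart d are the origins of alpha d.\<close>

definition local_mins :: "nat set \<Rightarrow> (nat \<Rightarrow> nat) \<Rightarrow> (nat \<Rightarrow> nat) \<Rightarrow> (nat \<Rightarrow> int) \<Rightarrow> nat set set" where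
  "local_mins D \<alpha> \<sigma> lb = {v \<in> f_orbits \<sigma> D. \<forall>d\<in>v. lb d \<le> lb (\<alpha> d)}"

definition local_maxs :: "nat set \<Rightarrow> (nat \<Rightarrow> nat) \<Rightarrow> (nat \<Rightarrow> nat) \<Rightarrow> (nat \<Rightarrow> int) \<Rightarrow> nat set set" where
  "local_maxs D \<alpha> \<sigma> lb = {v \<in> f_orbits \<sigma> D. \<forall>d\<in>v. lb d \<ge> lb (\<alpha> d)}"

section \<open>Rooted labelled quadrangulations and maps\<close>

text \<open>Root of a quadrangulation: an unoriented edge, i.e. a set {r, alpha r}.\<close>
record lquad =
  qD :: "nat set"
  qalpha :: "nat \<Rightarrow> nat"
  qsigma :: "nat \<Rightarrow> nat"
  qlab :: "nat \<Rightarrow> int"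
  qroot :: "nat set"

text \<open>Root of a map: a corner, i.e. a dart.\<close>
record lmap =
  mD :: "nat set"
  malpha :: "nat \<Rightarrow> nat"
  msigma :: "nat \<Rightarrow> nat"
  mlab :: "nat \<Rightarrow> int"
  mroot :: nat

definition is_lquad :: "lquad \<Rightarrow> bool" where
  "is_lquad Q \<longleftrightarrow> is_quadrangulation (qD Q) (qalpha Q) (qsigma Q) \<and>
     (\<forall>d\<in>qD Q. qlab Q (qsigma Q d) = qlab Q d \<and> \<bar>qlab Q (qalpha Q d) - qlab Q d\<bar> = 1) \<and>
     (\<exists>r\<in>qD Q. qroot Q = {r, qalpha Q r})"

definition is_lmap :: "lmap \<Rightarrow> bool" where
  "is_lmap M \<longleftrightarrow> is_planar_map (mD M) (malpha M) (msigma M) \<and>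
     (\<forall>d\<in>mD M. mlab M (msigma M d) = mlab M d \<and> \<bar>mlab M (malpha M d) - mlab M d\<bar> \<le> 1) \<and>
     mroot M \<in> mD M"

text \<open>Isomorphism = orientation-preserving isomorphism of labelled rooted maps.\<close>
definition lquad_iso :: "lquad \<Rightarrow> lquad \<Rightarrow> bool" where
  "lquad_iso Q Q' \<longleftrightarrow> (\<exists>h. bij_betw h (qD Q) (qD Q') \<and>
     (\<forall>d\<in>qD Q. h (qalpha Q d) = qalpha Q' (h d) \<and> h (qsigma Q d) = qsigma Q' (h d) \<and>
        qlab Q' (h d) = qlab Q d) \<and>
     h ` qroot Q = qroot Q')"

definition lmap_iso :: "lmap \<Rightarrow> lmap \<Rightarrow> bool" where
  "lmap_iso M M' \<longleftrightarrow> (\<exists>h. bij_betw h (mD M) (mD M') \<and>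
     (\<forall>d\<in>mD M. h (malpha M d) = malpha M' (h d) \<and> h (msigma M d) = msigma M' (h d) \<and>
        mlab M' (h d) = mlab M d) \<and>
     h (mroot M) = mroot M')"

section \<open>Schaeffer's prescription\<close>

text \<open>First dart strictly after c (counterclockwise around its vertex) lying in S.\<close>
definition next_in :: "(nat \<Rightarrow> nat) \<Rightarrow> nat set \<Rightarrow> nat \<Rightarrow> nat" where
  "next_in \<sigma> S c = (\<sigma> ^^ (LEAST k. 0 < k \<and> (\<sigma> ^^ k) c \<in> S)) c"

text \<open>In a face with corners c, phi c, phi^2 c, phi^3 c (clockwise order), the corner
c is "top" if both neighbouring corners have label one less.  The new edges of
Psi(Q) are attached at corners of Q; a corner c of Q carries a dart of Psi(Q) iff
it is an endpoint of the new edge drawn in its face: a top corner, or the clockwise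
successor of the top corner of a simple face.  The new edge inside a corner is
strictly inside that sector, so the rotation of Psi(Q) is the induced cyclic
order, and the root corner is the sector containing the root edge at its
endpoint with the larger label.\<close>

definition sch_top :: "lquad \<Rightarrow> nat \<Rightarrow> bool" where
  "sch_top Q c \<longleftrightarrow> (let \<phi> = face_perm (qalpha Q) (qsigma Q); lb = qlab Q in
     lb (\<phi> c) = lb c - 1 \<and> lb ((\<phi> ^^ 3) c) = lb c - 1)"

definition sch_darts :: "lquad \<Rightarrow> nat set" where
  "sch_darts Q = (let \<phi> = face_perm (qalpha Q) (qsigma Q); lb = qlab Q in
     {c \<in> qD Q. sch_top Q c \<or>
        (sch_top Q ((\<phi> ^^ 3) c) \<and> lb (\<phi> c) = lb ((\<phi> ^^ 3) c) - 2)})"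

definition sch_alpha :: "lquad \<Rightarrow> nat \<Rightarrow> nat" where
  "sch_alpha Q c = (let \<phi> = face_perm (qalpha Q) (qsigma Q); lb = qlab Q in
     if sch_top Q c then (if lb ((\<phi> ^^ 2) c) = lb c then (\<phi> ^^ 2) c else \<phi> c)
     else (\<phi> ^^ 3) c)"

definition psi :: "lquad \<Rightarrow> lmap" where
  "psi Q = (let DM = sch_darts Q;
                d = (THE d. d \<in> qroot Q \<and> qlab Q (qalpha Q d) < qlab Q d) in
     \<lparr> mD = DM, malpha = sch_alpha Q, msigma = next_in (qsigma Q) DM,
       mlab = qlab Q, mroot = next_in (qsigma Q) DM d \<rparr>)"

end

theory Submission
  imports Defs
begin

text \<open>Every edge of the quadrangulation descends from exactly one of its two darts, and the corners
  carrying a dart of the map turn out to be exactly these descending darts.  Write \<open>a\<close> and \<open>m\<close> for the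
  edge involution and the vertex rotation of the map on them.  The orbits of \<open>th = a \<circ> m\<close> are
  (up to conjugation by \<open>a\<close>) the faces of the map, and along such an orbit the labels
  change by at most one.  The key fact is that two ascending darts
  consecutive around a vertex are the reverses of the two ends of an excursion of \<open>th\<close> above a level;
  it is proved by decreasing induction on the label.

  Consequently the descending darts pointing to a local minimum are exactly the darts of smallest
  label in one orbit of \<open>th\<close>, which matches local minima with faces of the map; the vertices of the
  quadrangulation are the vertices of the map plus the local minima, and Euler characteristic and
  connectedness agree on both sides.  The excursions also express the rotation of the
  quadrangulation through \<open>a\<close>, \<open>m\<close> and the labels, which gives injectivity; read as
  a definition, this expression produces a preimage of every map.\<close>

section \<open>Orbits of permutations of a finite set\<close>

text \<open>Read clockwise, a simple face descends at its top and at the successor of the top, a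
  confluent face at its two tops: exactly the ends of the new edge. Hence \<open>dn\<close> itself
  serves as the dart set of the map, with \<open>m\<close> the first-return map of the rotation. The
  obstacle is that ascending darts, and with them the local minima, are invisible in the map. What
  survives of an ascending dart \<open>u\<close> is its reverse \<open>al u\<close>, so every
  statement about the rotation is turned into one about reverses on an orbit of \<open>th\<close>. A
  block of ascending darts after a descending dart of label t becomes a chain of excursions above t
  + 1, met against the rotation, and this chain fills one excursion above t. As labels on a finite
  set are bounded, the decreasing induction closes. The local analysis lives in a locale that
  assumes neither planarity nor connectedness: the inverse construction first yields only
  degree-four faces and admissible labels, and both properties are then pulled back from the map
  through \<open>planar_psi\<close>.\<close>

lemma f_orbit_self: "x \<in> f_orbit f x"
  unfolding f_orbit_def by (rule range_eqI[of _ _ 0]) simp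

lemma f_orbit_step: "f x \<in> f_orbit f x"
  unfolding f_orbit_def by (rule range_eqI[of _ _ 1]) simp

lemma f_orbit_pow: "(f ^^ n) x \<in> f_orbit f x"
  unfolding f_orbit_def by blast

locale finite_perm =
  fixes D :: "nat set" and f :: "nat \<Rightarrow> nat"
  assumes fin: "finite D" and bij: "bij_betw f D D"
begin

lemma in_D: "d \<in> D \<Longrightarrow> f d \<in> D"
  using bij bij_betwE by blast

lemma inj: "x \<in> D \<Longrightarrow> y \<in> D \<Longrightarrow> f x = f y \<Longrightarrow> x = y"
  using bij by (meson bij_betw_imp_inj_on inj_onD)

lemma surj: "y \<in> D \<Longrightarrow> \<exists>x\<in>D. f x = y"
  using bij by (metis bij_betw_imp_surj_on imageE)

lemma pow_in: "d \<in> D \<Longrightarrow> (f ^^ n) d \<in> D"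
  by (induction n) (auto simp: in_D)

lemma pow_inj: "x \<in> D \<Longrightarrow> y \<in> D \<Longrightarrow> (f ^^ n) x = (f ^^ n) y \<Longrightarrow> x = y"
  by (induction n) (auto dest: inj[OF pow_in pow_in])

lemma pow_cancel:
  assumes "x \<in> D" "y \<in> D" "(f ^^ i) x = (f ^^ j) y" "i \<le> j"
  shows "x = (f ^^ (j - i)) y"
proof -
  have "(f ^^ i) x = (f ^^ i) ((f ^^ (j - i)) y)"
    using assms by (simp flip: comp_apply[of "f ^^ i"] funpow_add)
  then show ?thesis using pow_inj pow_in assms by blast
qed

lemma returns: assumes "d \<in> D" shows "\<exists>n>0. (f ^^ n) d = d"
proof -
  have "\<not> inj_on (\<lambda>n. (f ^^ n) d) UNIV"
    using fin pow_in[OF assms]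
    by (metis finite_imageD finite_subset image_subset_iff infinite_UNIV_nat)
  then obtain i j where "i < j" "(f ^^ i) d = (f ^^ j) d"
    unfolding inj_on_def by (metis linorder_neqE_nat)
  then have "d = (f ^^ (j - i)) d" "0 < j - i"
    using pow_cancel[OF assms assms] by auto
  then show ?thesis by metis
qed

lemma orbit_sub: "d \<in> D \<Longrightarrow> f_orbit f d \<subseteq> D"
  unfolding f_orbit_def using pow_in by blast

text \<open>With p a period of \<open>x\<close>, another p * n - n steps after the first n complete
  n full periods, so the way back is again a power of \<open>f\<close>.\<close>

lemma orbit_sym: assumes "x \<in> D" "y \<in> f_orbit f x" shows "x \<in> f_orbit f y"
proof -
  obtain n where n: "y = (f ^^ n) x" using assms unfolding f_orbit_def by blast
  obtain p where p: "p > 0" "(f ^^ p) x = x" using returns assms by blast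
  have "(f ^^ (p * k)) x = x" for k
    by (induction k) (simp_all add: funpow_add p)
  moreover have "(p * n - n) + n = p * n" using p by simp
  ultimately have "(f ^^ (p * n - n)) y = x"
    unfolding n by (metis comp_apply funpow_add)
  then show ?thesis using f_orbit_pow by metis
qed

lemma orbit_mono: assumes "y \<in> f_orbit f x" shows "f_orbit f y \<subseteq> f_orbit f x"
  using assms unfolding f_orbit_def by (auto simp flip: comp_apply[of "f ^^ _"] funpow_add)

lemma orbit_eq: "x \<in> D \<Longrightarrow> y \<in> f_orbit f x \<Longrightarrow> f_orbit f y = f_orbit f x"
  using orbit_mono orbit_sym by blast

lemma orbits_fin: "finite (f_orbits f D)"
  unfolding f_orbits_def using fin by simp

lemma Union_orbits: "\<Union> (f_orbits f D) = D"
  unfolding f_orbits_def using orbit_sub f_orbit_self by fastforce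

lemma card_orbits:
  assumes "\<And>d. d \<in> D \<Longrightarrow> card (f_orbit f d) = k"
  shows "k * card (f_orbits f D) = card D"
proof -
  have "k * card (f_orbits f D) = card (\<Union> (f_orbits f D))"
  proof (rule card_partition)
    fix u v assume "u \<in> f_orbits f D" "v \<in> f_orbits f D" "u \<noteq> v"
    then show "u \<inter> v = {}"
      unfolding f_orbits_def using orbit_eq by blast
  qed (use assms in \<open>auto simp: orbits_fin Union_orbits fin f_orbits_def finite_subset[OF orbit_sub fin]\<close>)
  then show ?thesis by (simp add: Union_orbits)
qed

lemma card_orbit_period:
  assumes "d \<in> D" "0 < n" "(f ^^ n) d = d" "\<And>i. 0 < i \<Longrightarrow> i < n \<Longrightarrow> (f ^^ i) d \<noteq> d"
  shows "card (f_orbit f d) = n"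
proof -
  have "(f ^^ k) d = (f ^^ (k mod n)) d" for k
    using assms(3) funpow_mod_eq by metis
  then have "f_orbit f d = (\<lambda>i. (f ^^ i) d) ` {..<n}"
    unfolding f_orbit_def using assms(2)
    by (auto intro!: image_eqI[of _ _ "_ mod n"])
  moreover have "inj_on (\<lambda>i. (f ^^ i) d) {..<n}"
  proof (rule linorder_inj_onI)
    fix i j assume *: "i < j" "i \<in> {..<n}" "j \<in> {..<n}"
    show "(f ^^ i) d \<noteq> (f ^^ j) d"
    proof
      assume "(f ^^ i) d = (f ^^ j) d"
      then have "d = (f ^^ (j - i)) d" using pow_cancel[OF assms(1,1)] * by simp
      moreover have "0 < j - i" "j - i < n" using * by auto
      ultimately show False using assms(4) by metis
    qed
  qed auto
  ultimately show ?thesis by (simp add: card_image)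
qed

text \<open>The right-hand side excludes periods 1 and 2, and period 3 together with the
  fourth-power identity would force a fixed point. This turns the degree condition into rewrite
  rules.\<close>

lemma card_orbit_4_iff:
  assumes "d \<in> D"
  shows "card (f_orbit f d) = 4 \<longleftrightarrow> f (f (f (f d))) = d \<and> f (f d) \<noteq> d"
proof
  assume L: "card (f_orbit f d) = 4"
  define n where "n = (LEAST n. 0 < n \<and> (f ^^ n) d = d)"
  have n: "0 < n \<and> (f ^^ n) d = d"
    unfolding n_def using returns[OF assms] by (rule LeastI_ex)
  have min: "(f ^^ i) d \<noteq> d" if "0 < i" "i < n" for i
    using not_less_Least[of i "\<lambda>n. 0 < n \<and> (f ^^ n) d = d"] that unfolding n_def by blast
  have "n = 4" using card_orbit_period[OF assms _ _ min] n L by simp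
  then show "f (f (f (f d))) = d \<and> f (f d) \<noteq> d"
    using n min[of 2] by (simp add: numeral_eq_Suc)
next
  assume R: "f (f (f (f d))) = d \<and> f (f d) \<noteq> d"
  show "card (f_orbit f d) = 4"
  proof (rule card_orbit_period[OF assms])
    fix i :: nat assume "0 < i" "i < 4"
    then consider "i = 1" | "i = 2" | "i = 3" by linarith
    then show "(f ^^ i) d \<noteq> d" using R by cases (auto simp: numeral_eq_Suc)
  qed (use R in \<open>simp_all add: numeral_eq_Suc\<close>)
qed

end

section \<open>Transport of orbits, and first-return maps\<close>

lemma card_f_orbits_transport:
  assumes "inj_on h D" "h ` D = D'" "\<And>d. d \<in> D \<Longrightarrow> f d \<in> D" "\<And>d. d \<in> D \<Longrightarrow> h (f d) = f' (h d)"
  shows "card (f_orbits f' D') = card (f_orbits f D)"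
proof -
  have pow: "(f ^^ n) d \<in> D \<and> h ((f ^^ n) d) = (f' ^^ n) (h d)" if "d \<in> D" for n d
    using that assms(3,4) by (induction n) auto
  have orb: "f_orbit f' (h d) = h ` f_orbit f d" if "d \<in> D" for d
    unfolding f_orbit_def using pow[OF that] by (auto simp: image_iff)
  have "f_orbits f' D' = (`) h ` f_orbits f D"
    unfolding f_orbits_def assms(2)[symmetric] image_image using orb by auto
  moreover have "inj_on ((`) h) (f_orbits f D)"
  proof (rule inj_on_subset[OF inj_on_image_Pow[OF assms(1)]])
    show "f_orbits f D \<subseteq> Pow D" unfolding f_orbits_def f_orbit_def using pow by auto
  qed
  ultimately show ?thesis by (simp add: card_image)
qed

lemma next_in_eqI:
  assumes "0 < k" "(s ^^ k) c \<in> S" "\<And>i. 0 < i \<Longrightarrow> i < k \<Longrightarrow> (s ^^ i) c \<notin> S"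
  shows "next_in s S c = (s ^^ k) c"
proof -
  have "(LEAST k. 0 < k \<and> (s ^^ k) c \<in> S) = k"
    using assms by (intro Least_equality) (auto simp: not_less[symmetric])
  then show ?thesis unfolding next_in_def by simp
qed

lemma next_in_step: "s c \<in> S \<Longrightarrow> next_in s S c = s c"
  using next_in_eqI[of 1 s c S] by simp

context finite_perm
begin

lemma next_in_obtain:
  assumes "c \<in> S" "S \<subseteq> D"
  obtains k where "0 < k" "next_in f S c = (f ^^ k) c" "(f ^^ k) c \<in> S"
    "\<And>i. 0 < i \<Longrightarrow> i < k \<Longrightarrow> (f ^^ i) c \<notin> S"
proof -
  define k where "k = (LEAST k. 0 < k \<and> (f ^^ k) c \<in> S)"
  have "\<exists>n>0. (f ^^ n) c \<in> S" using returns[of c] assms by (metis subsetD)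
  then have "0 < k \<and> (f ^^ k) c \<in> S" unfolding k_def by (rule LeastI_ex)
  moreover have "(f ^^ i) c \<notin> S" if "0 < i" "i < k" for i
    using not_less_Least[of i "\<lambda>k. 0 < k \<and> (f ^^ k) c \<in> S"] that unfolding k_def by blast
  ultimately show ?thesis using that[of k] next_in_eqI by metis
qed

lemma next_in_in: "c \<in> S \<Longrightarrow> S \<subseteq> D \<Longrightarrow> next_in f S c \<in> S"
  by (metis next_in_obtain)

text \<open>A collision would put one of the two points on the stretch between the other point and
  its first return, and that stretch avoids \<open>S\<close>.\<close>

lemma next_in_bij:
  assumes "S \<subseteq> D"
  shows "bij_betw (next_in f S) S S"
proof -
  have key: False if "x \<in> S" "y \<in> S" "x \<noteq> y" "0 < i" "i \<le> j" "(f ^^ i) x = (f ^^ j) y"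
      "\<And>i. 0 < i \<Longrightarrow> i < j \<Longrightarrow> (f ^^ i) y \<notin> S" for x y i j
  proof -
    have "x = (f ^^ (j - i)) y" using pow_cancel that assms by blast
    then show False using that by (cases "j = i") auto
  qed
  have "inj_on (next_in f S) S"
  proof (rule inj_onI, rule ccontr)
    fix x y assume *: "x \<in> S" "y \<in> S" "next_in f S x = next_in f S y" "x \<noteq> y"
    obtain i where i: "0 < i" "next_in f S x = (f ^^ i) x"
      "\<And>j. 0 < j \<Longrightarrow> j < i \<Longrightarrow> (f ^^ j) x \<notin> S" using next_in_obtain[OF *(1) assms] by metis
    obtain j where j: "0 < j" "next_in f S y = (f ^^ j) y"
      "\<And>i. 0 < i \<Longrightarrow> i < j \<Longrightarrow> (f ^^ i) y \<notin> S" using next_in_obtain[OF *(2) assms] by metis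
    show False
    proof (cases "i \<le> j")
      case True
      then show ?thesis using key[of x y i j] i j * by simp
    next
      case False
      then show ?thesis using key[of y x j i] i j * by simp
    qed
  qed
  moreover have "next_in f S ` S \<subseteq> S" using next_in_in assms by blast
  ultimately show ?thesis
    by (simp add: bij_betw_def endo_inj_surj finite_subset[OF assms fin])
qed

text \<open>Makes the vertices of the map the traces on \<open>dn\<close> of the vertices of the
  quadrangulation. For the harder inclusion, strong induction on the number of
  \<open>f\<close>-steps jumps from one visit of \<open>S\<close> to the next.\<close>

lemma orbit_next_in:
  assumes "S \<subseteq> D" "d \<in> S"
  shows "f_orbit (next_in f S) d = f_orbit f d \<inter> S"
proof
  have "(next_in f S ^^ n) d \<in> f_orbit f d \<inter> S" for n
  proof (induction n)
    case 0 show ?case using assms f_orbit_self by simp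
  next
    case (Suc n)
    then show ?case using next_in_obtain[of "(next_in f S ^^ n) d" S] assms
      by (metis Int_iff f_orbit_pow funpow.simps(2) comp_apply orbit_mono subsetD)
  qed
  then show "f_orbit (next_in f S) d \<subseteq> f_orbit f d \<inter> S" unfolding f_orbit_def by blast
next
  have "(f ^^ k) d \<in> f_orbit (next_in f S) d" if "(f ^^ k) d \<in> S" "d \<in> S" for k d
    using that
  proof (induction k arbitrary: d rule: less_induct)
    case (less k)
    show ?case
    proof (cases "k = 0")
      case True then show ?thesis by (simp add: f_orbit_self)
    next
      case False
      obtain j where j: "0 < j" "next_in f S d = (f ^^ j) d" "(f ^^ j) d \<in> S"
        "\<And>i. 0 < i \<Longrightarrow> i < j \<Longrightarrow> (f ^^ i) d \<notin> S" using next_in_obtain[OF less(3) assms(1)] by metis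
      have "j \<le> k" using j(4)[of k] less False by (meson not_le neq0_conv)
      then have eq: "(f ^^ k) d = (f ^^ (k - j)) (next_in f S d)"
        unfolding j(2) by (simp flip: comp_apply[of "f ^^ _"] funpow_add)
      have "(f ^^ (k - j)) (next_in f S d) \<in> f_orbit (next_in f S) (next_in f S d)"
        using less(1)[of "k - j" "next_in f S d"] eq j \<open>j \<le> k\<close> less(2) by simp
      then obtain n where "(f ^^ k) d = (next_in f S ^^ n) (next_in f S d)"
        unfolding eq f_orbit_def by blast
      then have "(f ^^ k) d = (next_in f S ^^ Suc n) d" by (simp only: funpow_Suc_right comp_apply)
      then show ?thesis using f_orbit_pow by metis
    qed
  qed
  then show "f_orbit f d \<inter> S \<subseteq> f_orbit (next_in f S) d"
    using assms unfolding f_orbit_def by auto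
qed

end

section \<open>Labelled quadrangulations without the planarity condition\<close>

locale labelled_quads =
  fixes Q :: lquad
  assumes fin: "finite (qD Q)" and ne: "qD Q \<noteq> {}"
    and alpha: "\<And>d. d \<in> qD Q \<Longrightarrow> qalpha Q d \<in> qD Q \<and> qalpha Q d \<noteq> d \<and> qalpha Q (qalpha Q d) = d"
    and sigma_bij: "bij_betw (qsigma Q) (qD Q) (qD Q)"
    and face4: "\<And>d. d \<in> qD Q \<Longrightarrow> card (f_orbit (face_perm (qalpha Q) (qsigma Q)) d) = 4"
    and lab_sigma: "\<And>d. d \<in> qD Q \<Longrightarrow> qlab Q (qsigma Q d) = qlab Q d"
    and lab_alpha: "\<And>d. d \<in> qD Q \<Longrightarrow> \<bar>qlab Q (qalpha Q d) - qlab Q d\<bar> = 1"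
begin

abbreviation "D \<equiv> qD Q"
abbreviation "al \<equiv> qalpha Q"
abbreviation "s \<equiv> qsigma Q"
abbreviation "lb \<equiv> qlab Q"
abbreviation "ph \<equiv> face_perm (qalpha Q) (qsigma Q)"

definition "dn = {d \<in> D. lb (al d) < lb d}"
abbreviation "m \<equiv> next_in s dn"
abbreviation "a \<equiv> sch_alpha Q"
text \<open>This conjugate of the face permutation \<open>m \<circ> a\<close> is preferred because,
  after a block of ascending darts, \<open>th e\<close> is the reverse of the last dart of the block
  (\<open>dn_then_up\<close>).\<close>

definition "th = a \<circ> m"

sublocale S: finite_perm D s
  using fin sigma_bij by unfold_locales

lemma al_D [simp]: "d \<in> D \<Longrightarrow> al d \<in> D" and al_neq: "d \<in> D \<Longrightarrow> al d \<noteq> d"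
  and al_al [simp]: "d \<in> D \<Longrightarrow> al (al d) = d"
  using alpha by auto

declare S.in_D [simp] lab_sigma [simp]

sublocale AL: finite_perm D al
  using fin by unfold_locales (auto intro!: bij_betw_byWitness[where f' = al])

lemma ph: "ph x = s (al x)"
  by (simp add: face_perm_def)

sublocale PH: finite_perm D ph
  unfolding face_perm_def using fin bij_betw_trans[OF AL.bij S.bij] by unfold_locales

declare PH.in_D [simp]

lemma ph4 [simp]: "x \<in> D \<Longrightarrow> ph (ph (ph (ph x))) = x" and ph2: "x \<in> D \<Longrightarrow> ph (ph x) \<noteq> x"
  using PH.card_orbit_4_iff[of x] face4[of x] by auto

lemma lab_ph: "x \<in> D \<Longrightarrow> lb (ph x) = lb (al x)"
  by (simp add: ph)

lemma lab_ph_step: "x \<in> D \<Longrightarrow> lb (ph x) = lb x + 1 \<or> lb (ph x) = lb x - 1"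
  using lab_alpha[of x] by (auto simp: ph)

section \<open>Descending darts and the new edges inside the faces\<close>

lemma dn_iff: "x \<in> dn \<longleftrightarrow> x \<in> D \<and> lb (ph x) = lb x - 1"
proof (cases "x \<in> D")
  case True
  then have "lb (al x) < lb x \<longleftrightarrow> lb (al x) = lb x - 1" using lab_alpha[of x] by linarith
  then show ?thesis using True by (simp add: dn_def lab_ph)
qed (simp add: dn_def)

lemma dn_D [simp]: "x \<in> dn \<Longrightarrow> x \<in> D"
  by (simp add: dn_def)

lemma dn_sub: "dn \<subseteq> D"
  by (auto simp: dn_def simp del: dn_D)

lemma not_dn:
  assumes "x \<in> D"
  shows "x \<notin> dn \<longleftrightarrow> lb (ph x) = lb x + 1"
  using lab_ph_step[OF assms] assms unfolding dn_iff by linarith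

lemma lab_al_dn: "x \<in> dn \<Longrightarrow> lb (al x) = lb x - 1"
  using dn_iff lab_ph by metis

lemma lab_al_up: "x \<in> D \<Longrightarrow> x \<notin> dn \<Longrightarrow> lb (al x) = lb x + 1"
  using not_dn lab_ph by metis

lemma al_dn_iff:
  assumes "x \<in> D"
  shows "al x \<in> dn \<longleftrightarrow> x \<notin> dn"
proof -
  have "lb (al x) \<noteq> lb x" using lab_alpha[OF assms] by linarith
  then show ?thesis using assms by (simp add: dn_def del: dn_D) linarith
qed

text \<open>The corner \<open>s y\<close> follows \<open>al y\<close> in its face, so three more
  steps close the quadrangle. This gives access to the face in the sector between \<open>y\<close>
  and \<open>s y\<close>.\<close>

lemma ph3: assumes "y \<in> D" shows "ph (ph (ph (s y))) = al y"
proof -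
  have "ph (al y) = s y" using assms by (simp add: ph)
  then show ?thesis using ph4[OF al_D[OF assms]] by simp
qed

text \<open>The four steps of size one around a face sum to zero; since the first descends, exactly
  one of the other three does, which leaves three patterns.\<close>

lemma face_labels:
  fixes p q r t :: int
  assumes "p = t - 1" "q = p + 1 \<or> q = p - 1" "r = q + 1 \<or> r = q - 1" "t = r + 1 \<or> t = r - 1"
  shows "q = t \<and> r = t - 1 \<or> q = t - 2 \<and> r = t - 1 \<or> q = t \<and> r = t + 1"
  using assms by presburger

text \<open>The case names give the role of \<open>c\<close>: a top of a confluent face, the top of
  a simple face, or the lower end of the new edge in a simple face.\<close>

lemma dn_cases:
  assumes "c \<in> dn"
  obtains (conf) "lb (ph (ph c)) = lb c" "lb (ph (ph (ph c))) = lb c - 1"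
  | (top) "lb (ph (ph c)) = lb c - 2" "lb (ph (ph (ph c))) = lb c - 1"
  | (bot) "lb (ph (ph c)) = lb c" "lb (ph (ph (ph c))) = lb c + 1"
proof -
  have c: "c \<in> D" "lb (ph c) = lb c - 1" using assms by (auto simp: dn_iff simp del: dn_D)
  have "ph c \<in> D" "ph (ph c) \<in> D" "ph (ph (ph c)) \<in> D" "lb (ph (ph (ph (ph c)))) = lb c"
    using c(1) by auto
  note this(1-3)[THEN lab_ph_step, unfolded this(4)]
  with c(2) have "lb (ph (ph c)) = lb c \<and> lb (ph (ph (ph c))) = lb c - 1
     \<or> lb (ph (ph c)) = lb c - 2 \<and> lb (ph (ph (ph c))) = lb c - 1
     \<or> lb (ph (ph c)) = lb c \<and> lb (ph (ph (ph c))) = lb c + 1"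
    by (rule face_labels)
  then show ?thesis using that by blast
qed

lemma sch_top_dn:
  assumes "c \<in> dn"
  shows "sch_top Q c \<longleftrightarrow> lb (ph (ph (ph c))) = lb c - 1"
  using assms by (simp add: sch_top_def Let_def numeral_eq_Suc dn_iff del: dn_D)

lemma sch_darts: "sch_darts Q = dn"
proof (intro set_eqI iffI)
  fix c assume "c \<in> sch_darts Q"
  then show "c \<in> dn"
    unfolding sch_darts_def sch_top_def dn_iff by (auto simp: Let_def numeral_eq_Suc)
next
  fix c assume c: "c \<in> dn"
  then have *: "lb (ph c) = lb c - 1" "c \<in> D" by (auto simp: dn_iff simp del: dn_D)
  show "c \<in> sch_darts Q"
    using c * by (cases rule: dn_cases) (simp_all add: sch_darts_def sch_top_def Let_def numeral_eq_Suc)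
qed

lemma a_conf:
  assumes "c \<in> dn" "lb (ph (ph c)) = lb c" "lb (ph (ph (ph c))) = lb c - 1"
  shows "a c = ph (ph c)"
  using assms sch_top_dn[OF assms(1)] by (simp add: sch_alpha_def Let_def numeral_eq_Suc)

lemma a_top:
  assumes "c \<in> dn" "lb (ph (ph c)) = lb c - 2"
  shows "a c = ph c"
  using assms sch_top_dn[OF assms(1)] dn_cases[OF assms(1)]
  by (auto simp: sch_alpha_def Let_def numeral_eq_Suc)

lemma a_bot:
  assumes "c \<in> dn" "lb (ph (ph (ph c))) = lb c + 1"
  shows "a c = ph (ph (ph c))"
  using assms sch_top_dn[OF assms(1)] by (simp add: sch_alpha_def Let_def numeral_eq_Suc)

lemma a_cases:
  assumes "c \<in> dn"
  obtains (conf) "lb (ph (ph c)) = lb c" "lb (ph (ph (ph c))) = lb c - 1" "a c = ph (ph c)" "lb (a c) = lb c"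
  | (top) "lb (ph (ph c)) = lb c - 2" "lb (ph (ph (ph c))) = lb c - 1" "a c = ph c" "lb (a c) = lb c - 1"
  | (bot) "lb (ph (ph c)) = lb c" "lb (ph (ph (ph c))) = lb c + 1" "a c = ph (ph (ph c))" "lb (a c) = lb c + 1"
  using assms
proof (cases rule: dn_cases)
  case conf then show ?thesis using that(1) a_conf[OF assms] by simp
next
  case top then show ?thesis using that(2) a_top[OF assms] assms by (simp add: dn_iff del: dn_D)
next
  case bot then show ?thesis using that(3) a_bot[OF assms] by simp
qed

lemma lab_ph_dn: "c \<in> dn \<Longrightarrow> lb (ph c) = lb c - 1"
  by (simp add: dn_iff del: dn_D)

lemma a_dn [simp]: assumes "c \<in> dn" shows "a c \<in> dn"
  using assms
proof (cases rule: a_cases)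
  case conf
  have "lb (ph (a c)) = lb (a c) - 1" "a c \<in> D" unfolding conf(3) using conf(1,2) assms by simp_all
  then show ?thesis by (simp add: dn_iff del: dn_D)
next
  case top
  have "lb (ph (a c)) = lb (a c) - 1" "a c \<in> D"
    unfolding top(3) using top(1) lab_ph_dn[OF assms] assms by simp_all
  then show ?thesis by (simp add: dn_iff del: dn_D)
next
  case bot
  have "lb (ph (a c)) = lb (a c) - 1" "a c \<in> D"
    unfolding bot(3) using bot(2) assms by simp_all
  then show ?thesis by (simp add: dn_iff del: dn_D)
qed

lemma a_a [simp]: assumes "c \<in> dn" shows "a (a c) = c"
  using assms
proof (cases rule: a_cases)
  case conf
  have "a (a c) = ph (ph (a c))"
    by (rule a_conf[OF a_dn[OF assms]]) (use conf assms lab_ph_dn in simp_all)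
  then show ?thesis using conf assms by simp
next
  case top
  have "a (a c) = ph (ph (ph (a c)))"
    by (rule a_bot[OF a_dn[OF assms]]) (use top assms in simp)
  then show ?thesis using top assms by simp
next
  case bot
  have "a (a c) = ph (a c)"
    by (rule a_top[OF a_dn[OF assms]]) (use bot assms lab_ph_dn in simp)
  then show ?thesis using bot assms by simp
qed

lemma a_neq: assumes "c \<in> dn" shows "a c \<noteq> c"
proof
  assume eq: "a c = c"
  show False
    using assms
  proof (cases rule: a_cases)
    case conf
    then show ?thesis using eq ph2[of c] assms by simp
  next
    case top
    show ?thesis using top(4) unfolding eq by simp
  next
    case bot
    show ?thesis using bot(4) unfolding eq by simp
  qed
qed

lemma lab_a: assumes "c \<in> dn" shows "\<bar>lb (a c) - lb c\<bar> \<le> 1"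
  using assms
proof (cases rule: a_cases)
  case conf show ?thesis using conf(4) by simp
next
  case top show ?thesis using top(4) by simp
next
  case bot show ?thesis using bot(4) by simp
qed

section \<open>Rotation and face permutation of the map\<close>

sublocale M: finite_perm dn m
  using S.next_in_bij[OF dn_sub] finite_subset[OF dn_sub fin] by unfold_locales

sublocale A: finite_perm dn a
  using M.fin by unfold_locales (auto intro!: bij_betw_byWitness[where f' = a])

sublocale TH: finite_perm dn th
  unfolding th_def using M.fin bij_betw_trans[OF M.bij A.bij] by unfold_locales

lemma lab_s_pow: "x \<in> D \<Longrightarrow> lb ((s ^^ n) x) = lb x"
proof (induction n)
  case (Suc n)
  then show ?case using lab_sigma[OF S.pow_in[of x n]] by simp
qed simp

declare M.in_D [simp] TH.in_D [simp]

lemma lab_m [simp]: assumes "x \<in> dn" shows "lb (m x) = lb x"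
proof -
  obtain k where "m x = (s ^^ k) x" by (rule S.next_in_obtain[OF assms dn_sub])
  then show ?thesis using lab_s_pow assms by simp
qed

lemma lab_th: "x \<in> dn \<Longrightarrow> \<bar>lb (th x) - lb x\<bar> \<le> 1"
  using lab_a[of "m x"] by (simp add: th_def)

text \<open>The sector between \<open>u\<close> and \<open>s u\<close> lies in a simple face with
  top \<open>al u\<close>, and the new edge joins this top to its successor
  \<open>s u\<close>.\<close>

lemma up_then_dn:
  assumes "u \<in> D" "u \<notin> dn" "s u \<in> dn"
  shows "a (s u) = al u" "lb (al u) = lb u + 1"
proof -
  have "ph (ph (ph (s u))) = al u" using ph3 assms by blast
  then show "a (s u) = al u" "lb (al u) = lb u + 1"
    using a_bot[OF assms(3)] lab_al_up[OF assms(1,2)] assms by auto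
qed

text \<open>The corner preceding \<open>s e\<close> in its face is \<open>al e\<close>, of smaller
  label. So \<open>s e\<close> is not the lower end of a new edge, and its new edge cannot
  ascend.\<close>

lemma dn_then_dn:
  assumes "e \<in> dn" "s e \<in> dn"
  shows "m e = s e" "lb (th e) \<le> lb e"
proof -
  show *: "m e = s e" using next_in_step assms by metis
  have "ph (ph (ph (s e))) = al e" using ph3 assms by simp
  then have "lb (a (s e)) \<le> lb (s e)"
    using lab_al_dn[OF assms(1)] lab_sigma[of e] assms(1)
    by (cases rule: a_cases[OF assms(2)]) simp_all
  then show "lb (th e) \<le> lb e" using * assms by (simp add: th_def)
qed

text \<open>The exponent k - 1 marks the last ascending dart before \<open>m e\<close>;
  \<open>up_then_dn\<close> applies there.\<close>

lemma dn_then_up: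
  assumes "e \<in> dn" "s e \<notin> dn"
  obtains k where "1 < k" "m e = (s ^^ k) e" "\<And>i. 0 < i \<Longrightarrow> i < k \<Longrightarrow> (s ^^ i) e \<notin> dn"
    "al (th e) = (s ^^ (k - 1)) e" "lb (th e) = lb e + 1"
proof -
  obtain k where k: "0 < k" "m e = (s ^^ k) e" "(s ^^ k) e \<in> dn"
    "\<And>i. 0 < i \<Longrightarrow> i < k \<Longrightarrow> (s ^^ i) e \<notin> dn"
    by (rule S.next_in_obtain[OF assms(1) dn_sub]) blast
  have "k \<noteq> 1" using assms(2) k(3) by auto
  then have "1 < k" using k(1) by simp
  define u where "u = (s ^^ (k - 1)) e"
  have u: "u \<in> D" "u \<notin> dn" "s u = m e" "lb u = lb e"
  proof -
    show "u \<in> D" "lb u = lb e" unfolding u_def using assms S.pow_in lab_s_pow by simp_all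
    show "u \<notin> dn" unfolding u_def using k(4) \<open>1 < k\<close> by simp
    have "s u = (s ^^ Suc (k - 1)) e" unfolding u_def by simp
    then show "s u = m e" unfolding k(2) using \<open>1 < k\<close> by simp
  qed
  have "th e = al u" "lb (al u) = lb u + 1"
    using up_then_dn[of u] u assms by (auto simp: th_def)
  then show ?thesis using that[OF \<open>1 < k\<close> k(2,4)] u by (simp add: u_def)
qed

text \<open>For the ascending dart \<open>u = al x\<close> one has \<open>ph x = s u\<close>. Thus
  \<open>a\<close> and the labels decide whether the rotation after \<open>u\<close> meets a
  descending dart, and which one.\<close>

lemma al_s_dn_iff:
  assumes "x \<in> dn"
  shows "ph x \<in> dn \<longleftrightarrow> lb (a x) = lb x - 1" "ph x \<in> dn \<Longrightarrow> ph x = a x"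
proof -
  have x: "x \<in> D" "lb (ph x) = lb x - 1" using assms lab_ph_dn by simp_all
  have *: "ph x \<in> dn \<longleftrightarrow> lb (ph (ph x)) = lb x - 2"
    using x by (simp add: dn_iff del: dn_D)
  show "ph x \<in> dn \<longleftrightarrow> lb (a x) = lb x - 1"
    unfolding * using assms by (cases rule: a_cases) linarith+
  assume "ph x \<in> dn"
  then show "ph x = a x"
    unfolding * using a_top[OF assms] by simp
qed

end

text \<open>A first return to the starting label from above; a single step at constant label counts,
  with n = 1. It is kept generic in \<open>f\<close> and \<open>l\<close> because it is used on both
  sides of the correspondence and transported along isomorphisms.\<close>

definition excursion :: "(nat \<Rightarrow> nat) \<Rightarrow> (nat \<Rightarrow> int) \<Rightarrow> nat \<Rightarrow> nat \<Rightarrow> bool" where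
  "excursion f l e x \<longleftrightarrow>
     (\<exists>n>0. (f ^^ n) e = x \<and> l x = l e \<and> (\<forall>i. 0 < i \<and> i < n \<longrightarrow> l e < l ((f ^^ i) e)))"

section \<open>Excursions bounded by ascending darts\<close>

context labelled_quads
begin

abbreviation "exc \<equiv> excursion th lb"

text \<open>With t the label of \<open>e\<close>, the face between \<open>e\<close> and
  \<open>s e\<close> has labels t, t + 1, t, t - 1 from \<open>s e\<close> on, so it is simple with
  top \<open>ph (s e)\<close>. Its new edge is the closing step of the excursion from
  \<open>e\<close>.\<close>

lemma next_level:
  assumes "e \<in> dn" "s e \<notin> dn"
  shows "s (al (s e)) \<in> dn" "lb (al (s e)) = lb e + 1" "th (al (s e)) = ph (ph (s e))" "lb (ph (ph (s e))) = lb e"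
    "al (s e) \<in> dn"
proof -
  define y where "y = s e"
  have y: "y \<in> D" "y \<notin> dn" "lb y = lb e" "ph (ph (ph y)) = al e" "lb (al e) = lb e - 1"
    unfolding y_def using assms ph3 lab_al_dn by auto
  have 1: "lb (ph y) = lb e + 1" using y(2,3) not_dn[OF y(1)] by linarith
  have "lb (ph (ph (ph y))) = lb e - 1" using y(4,5) by simp
  then have 2: "lb (ph (ph y)) = lb e"
    using 1 lab_ph_step[of "ph y"] lab_ph_step[of "ph (ph y)"] PH.in_D[OF y(1)] PH.in_D[OF PH.in_D[OF y(1)]]
    by linarith
  have c: "ph y \<in> dn" using 1 2 y(1) by (simp add: dn_iff del: dn_D)
  have w: "al y \<in> dn" using y al_dn_iff by simp
  have "m (al y) = ph y" using dn_then_dn(1)[OF w] c y(1) by (simp add: ph)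
  moreover have "a (ph y) = ph (ph y)"
    using a_top[OF c] y(4,5) 1 by simp
  ultimately have t: "th (al y) = ph (ph y)" by (simp add: th_def)
  show "s (al (s e)) \<in> dn" using c by (simp add: ph y_def)
  show "lb (al (s e)) = lb e + 1" using lab_al_up y unfolding y_def by simp
  show "th (al (s e)) = ph (ph (s e))" "lb (ph (ph (s e))) = lb e" "al (s e) \<in> dn"
    using t 2 w unfolding y_def by simp_all
qed

text \<open>Two consecutive upward darts bound an excursion, and so do a downward dart and the upward
  dart following it; each case reduces to the other one, at the next higher label.\<close>

lemma exc_step:
  assumes ex: "\<And>x. x \<in> dn \<Longrightarrow> ph x \<notin> dn \<Longrightarrow> lb x = lb e + 1 \<Longrightarrow> exc (al (ph x)) x"
    and e: "e \<in> dn" "s e \<notin> dn"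
  shows "exc e (th (al (s e)))"
proof -
  obtain k where k: "1 < k" "m e = (s ^^ k) e" "\<And>i. 0 < i \<Longrightarrow> i < k \<Longrightarrow> (s ^^ i) e \<notin> dn"
    "al (th e) = (s ^^ (k - 1)) e" "lb (th e) = lb e + 1" using dn_then_up[OF e] by metis
  \<comment> \<open>A partial excursion: the path has reached \<open>w\<close> but not yet come back
    to the label of \<open>e\<close>, so the bound includes its last point.\<close>
  define P where "P w \<longleftrightarrow> (\<exists>n>0. (th ^^ n) e = w \<and> (\<forall>i. 0 < i \<and> i \<le> n \<longrightarrow> lb e < lb ((th ^^ i) e)))" for w
  have "P (al ((s ^^ i) e))" if "1 \<le> i" "i \<le> k - 1" for i
    \<comment> \<open>The induction runs downwards from k - 1: \<open>th\<close> meets the reverses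
      of the ascending block against the rotation, entering at the last one.\<close>
    using that(2,1)
  proof (induction rule: inc_induct)
    case base
    have "al (al (th e)) = th e" using e by simp
    then have "al ((s ^^ (k - 1)) e) = th e" using k(4) by simp
    then show ?case unfolding P_def using k(5)
      by (intro exI[of _ 1]) (auto simp: le_Suc_eq)
  next
    case (step i)
    define u where "u = (s ^^ i) e"
    have u: "u \<in> D" "u \<notin> dn" "s u \<notin> dn" "lb u = lb e" "s u = (s ^^ Suc i) e" "s u \<in> D"
      unfolding u_def using k(3)[of i] k(3)[of "Suc i"] step e S.pow_in lab_s_pow by auto
    obtain n where n: "n > 0" "(th ^^ n) e = al (s u)" "\<And>i. 0 < i \<Longrightarrow> i \<le> n \<Longrightarrow> lb e < lb ((th ^^ i) e)"
      using step.IH unfolding P_def u(5) by auto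
    have "exc (al (s u)) (al u)"
      using ex[of "al u"] u al_dn_iff lab_al_up by (simp add: ph)
    then obtain p where p: "p > 0" "(th ^^ p) (al (s u)) = al u"
       "\<And>i. 0 < i \<Longrightarrow> i < p \<Longrightarrow> lb (al (s u)) < lb ((th ^^ i) (al (s u)))"
      unfolding excursion_def by blast
    have lsu: "lb (al (s u)) = lb e + 1" "lb (al u) = lb e + 1"
      using lab_al_up[OF u(1,2)] lab_al_up[OF u(6,3)] u(4) lab_sigma[OF u(1)] by simp_all
    have "(th ^^ (p + n)) e = al u" using n p by (simp add: funpow_add)
    moreover have "lb e < lb ((th ^^ i) e)" if "0 < i" "i \<le> p + n" for i
    proof (cases "i \<le> n")
      case True then show ?thesis using n that by blast
    next
      case False
      then have "(th ^^ i) e = (th ^^ (i - n)) (al (s u))"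
        unfolding n(2)[symmetric] by (simp flip: comp_apply[of "th ^^ _"] funpow_add)
      moreover have "i - n \<le> p" "0 < i - n" using False that by auto
      ultimately show ?thesis using p(2) p(3)[of "i - n"] lsu
        by (cases "i - n = p") auto
    qed
    ultimately show ?case unfolding P_def u_def[symmetric] using n(1)
      by (intro exI[of _ "p + n"]) auto
  qed
  from this[of 1] k(1) have "P (al (s e))" by simp
  then obtain n where n: "n > 0" "(th ^^ n) e = al (s e)" "\<And>i. 0 < i \<Longrightarrow> i \<le> n \<Longrightarrow> lb e < lb ((th ^^ i) e)"
    unfolding P_def by blast
  then show ?thesis
    unfolding excursion_def using next_level[OF e]
    by (intro exI[of _ "Suc n"]) auto
qed

lemma exc_up_up: "x \<in> dn \<Longrightarrow> ph x \<notin> dn \<Longrightarrow> exc (al (ph x)) x"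
proof (induction "nat (Max (lb ` D) - lb x)" arbitrary: x rule: less_induct)
  case less
  define y where "y = ph x"
  define f where "f = al y"
  have y: "y \<in> D" "y \<notin> dn" "ph (ph (ph y)) = x" "lb y = lb x - 1"
    using less.prems by (auto simp: y_def dn_iff simp del: dn_D)
  have f: "f \<in> dn" "lb f = lb x" "ph y = s f"
    unfolding f_def using y al_dn_iff[of y] lab_al_up[of y] by (auto simp: ph)
  have xm: "lb z \<le> Max (lb ` D)" if "z \<in> D" for z using fin that by simp
  show ?case
  \<comment> \<open>The face has corners \<open>x\<close>, \<open>y\<close>, \<open>s f\<close> and
    a fourth one. If \<open>s f\<close> descends, the face is confluent and its diagonal alone is
    the excursion; otherwise \<open>next_level\<close> identifies \<open>x\<close> with the end of
    the excursion from \<open>f\<close>, which consists of excursions one label higher.\<close>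
  proof (cases "s f \<in> dn")
    case True
    have "lb (ph (ph y)) = lb x - 1" using lab_ph_dn[OF True] unfolding f(3) using f(1,2) by simp
    then have "a (s f) = x"
      using a_conf[OF True] y(3,4) f(1,2) lab_ph_dn[OF less.prems(1)] unfolding f(3)[symmetric]
      by (simp add: f(3))
    then have "th f = x" using dn_then_dn(1)[OF f(1) True] by (simp add: th_def)
    then show ?thesis unfolding excursion_def f_def[unfolded y_def, symmetric] using f
      by (intro exI[of _ 1]) auto
  next
    case False
    have "exc f (th (al (s f)))"
    proof (rule exc_step[OF _ f(1) False])
      fix z assume z: "z \<in> dn" "ph z \<notin> dn" "lb z = lb f + 1"
      have "nat (Max (lb ` D) - lb z) < nat (Max (lb ` D) - lb x)"
        using z f xm[of z] by simp
      then show "exc (al (ph z)) z" using less.hyps z by blast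
    qed
    moreover have "th (al (s f)) = x" using next_level(3)[OF f(1) False] y f by simp
    ultimately show ?thesis by (simp add: f_def y_def)
  qed
qed

lemma exc_dn_up: "e \<in> dn \<Longrightarrow> s e \<notin> dn \<Longrightarrow> exc e (th (al (s e)))"
  using exc_step exc_up_up by blast

end

section \<open>Counting vertices, edges and faces\<close>

lemma funpow_split: "p \<le> n \<Longrightarrow> (f ^^ n) x = (f ^^ (n - p)) ((f ^^ p) x)"
  by (metis comp_apply funpow_add le_add_diff_inverse2)

context finite_perm
begin

lemma orbit_rtrancl:
  assumes "\<And>d. d \<in> D \<Longrightarrow> (d, f d) \<in> R\<^sup>*" "x \<in> D" "y \<in> f_orbit f x"
  shows "(x, y) \<in> R\<^sup>*"
proof -
  have "(x, (f ^^ n) x) \<in> R\<^sup>*" for n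
  proof (induction n)
    case (Suc n)
    then show ?case using assms(1)[OF pow_in[OF assms(2), of n]] by simp
  qed simp
  then show ?thesis using assms(3) unfolding f_orbit_def by blast
qed

lemma card_orbits_involution:
  assumes "\<And>d. d \<in> D \<Longrightarrow> f (f d) = d" "\<And>d. d \<in> D \<Longrightarrow> f d \<noteq> d"
  shows "2 * card (f_orbits f D) = card D"
proof (rule card_orbits, rule card_orbit_period)
  fix d i :: nat assume "d \<in> D" "0 < i" "i < 2"
  then have "i = 1" by simp
  then show "(f ^^ i) d \<noteq> d" using assms \<open>d \<in> D\<close> by simp
qed (use assms in \<open>simp_all add: numeral_eq_Suc\<close>)

end

section \<open>Local minima and orbits of \<open>th\<close>\<close>

context labelled_quads
begin

lemma up_up_exc:
  assumes "u \<in> D" "u \<notin> dn" "s u \<notin> dn"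
  shows "exc (al (s u)) (al u)"
proof -
  have "ph (al u) = s u" using assms by (simp add: ph)
  then show ?thesis using exc_up_up[of "al u"] assms al_dn_iff[OF assms(1)] by simp
qed

lemma exc_orbit: "exc e x \<Longrightarrow> x \<in> f_orbit th e"
  unfolding excursion_def using f_orbit_pow by metis

lemma local_min_up:
  assumes "u \<in> D" "f_orbit s u \<inter> dn = {}" "v \<in> f_orbit s u"
  shows "v \<in> D" "v \<notin> dn" "s v \<in> f_orbit s u" "s v \<notin> dn" "lb v = lb u"
proof -
  show v: "v \<in> D" "v \<notin> dn" using assms S.orbit_sub by blast+
  have "s v \<in> f_orbit s v" by (rule f_orbit_step)
  then show "s v \<in> f_orbit s u" using S.orbit_eq[OF assms(1,3)] by simp
  then show "s v \<notin> dn" using assms(2) by blast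
  show "lb v = lb u" using assms(1,3) lab_s_pow unfolding f_orbit_def by auto
qed

text \<open>All darts at a local minimum ascend, so excursions link the reverses of any two
  consecutive ones.\<close>

lemma local_min_same_orbit:
  assumes "u \<in> D" "f_orbit s u \<inter> dn = {}" "v \<in> f_orbit s u"
  shows "f_orbit th (al v) = f_orbit th (al u)"
proof -
  have "f_orbit th (al ((s ^^ i) u)) = f_orbit th (al u)" for i
  proof (induction i)
    case (Suc i)
    define w where "w = (s ^^ i) u"
    have w: "w \<in> D" "w \<notin> dn" "s w \<notin> dn" "s w \<in> D"
      using local_min_up[OF assms(1,2), of w] f_orbit_pow S.in_D unfolding w_def by auto
    have "al w \<in> f_orbit th (al (s w))" using exc_orbit[OF up_up_exc] w by blast
    moreover have "al (s w) \<in> dn" using w al_dn_iff by simp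
    ultimately have "f_orbit th (al w) = f_orbit th (al (s w))" using TH.orbit_eq by blast
    then show ?case using Suc unfolding w_def by simp
  qed simp
  then show ?thesis using assms(3) unfolding f_orbit_def by auto
qed

text \<open>Excursions lead from the reverse of each dart to that of the preceding dart around the
  vertex, so they cover the orbit and only their ends have the low label. The induction strips off
  one excursion at a time.\<close>

lemma local_min_orbit_labels:
  assumes "u \<in> D" "f_orbit s u \<inter> dn = {}"
  shows "(th ^^ n) (al u) \<in> al ` f_orbit s u \<or> lb u + 1 < lb ((th ^^ n) (al u))"
  using assms
proof (induction n arbitrary: u rule: less_induct)
  case (less n)
  show ?case
  proof (cases "n = 0")
    case True
    then show ?thesis using f_orbit_self by simp
  next
    case False
    obtain v where v: "v \<in> D" "s v = u" using S.surj less.prems(1) by blast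
    have "u \<in> f_orbit s v" using f_orbit_step v by metis
    then have orb: "f_orbit s v = f_orbit s u" using S.orbit_eq v by blast
    have v': "v \<in> f_orbit s u" using orb f_orbit_self by blast
    have vu: "v \<notin> dn" "s v \<notin> dn" "lb v = lb u" using local_min_up[OF less.prems v'] by auto
    have lu: "lb (al u) = lb u + 1" using lab_al_up less.prems(1) vu v by simp
    obtain p where p: "p > 0" "(th ^^ p) (al u) = al v"
      "\<And>i. 0 < i \<Longrightarrow> i < p \<Longrightarrow> lb (al u) < lb ((th ^^ i) (al u))"
      using up_up_exc[OF v(1) vu(1,2)] unfolding excursion_def v(2) by blast
    show ?thesis
    proof (cases "n < p")
      case True
      then show ?thesis using p(3)[of n] False lu by simp
    next
      case ge: False
      have eq: "(th ^^ n) (al u) = (th ^^ (n - p)) (al v)"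
        using funpow_split[of p n th "al u"] ge p(2) by simp
      have "n - p < n" using p(1) False by simp
      then show ?thesis using less.IH[of "n - p" v] v(1) orb less.prems(2) vu(3) unfolding eq by simp
    qed
  qed
qed

lemma local_mins_eq: "local_mins D al s lb = {v \<in> f_orbits s D. v \<inter> dn = {}}"
proof -
  have "(\<forall>d\<in>v. lb d \<le> lb (al d)) \<longleftrightarrow> v \<inter> dn = {}" if "v \<in> f_orbits s D" for v
  proof -
    have "v \<subseteq> D" using that S.orbit_sub unfolding f_orbits_def by blast
    then show ?thesis by (auto simp: dn_def not_less simp del: dn_D)
  qed
  then show ?thesis unfolding local_mins_def by blast
qed

text \<open>Take \<open>b\<close> of smallest label in the orbit and turn around the vertex of
  \<open>al b\<close>. Were an ascending \<open>u\<close> there followed by a descending dart, the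
  dart \<open>z\<close> with \<open>th z = al u\<close> would lie in the orbit one label below
  \<open>b\<close>.\<close>

lemma orbit_bottom:
  assumes "e \<in> dn"
  obtains u where "u \<in> D" "f_orbit s u \<inter> dn = {}" "f_orbit th (al u) = f_orbit th e"
proof -
  have "finite (f_orbit th e)" using TH.orbit_sub[OF assms] TH.fin finite_subset by blast
  moreover from this have "Min (lb ` f_orbit th e) \<in> lb ` f_orbit th e"
    using f_orbit_self by (intro Min_in) auto
  then obtain b where "b \<in> f_orbit th e" "lb b = Min (lb ` f_orbit th e)" by auto
  ultimately have b: "b \<in> f_orbit th e" "\<And>z. z \<in> f_orbit th e \<Longrightarrow> lb b \<le> lb z"
    by simp_all
  have bdn: "b \<in> dn" using b(1) TH.orbit_sub[OF assms] by blast
  have orb: "f_orbit th b = f_orbit th e" using TH.orbit_eq[OF assms b(1)] .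
  have "(s ^^ i) (al b) \<in> D \<and> (s ^^ i) (al b) \<notin> dn \<and> al ((s ^^ i) (al b)) \<in> f_orbit th e" for i
  proof (induction i)
    case 0
    show ?case using bdn b(1) al_dn_iff[of b] by simp
  next
    case (Suc i)
    define u where "u = (s ^^ i) (al b)"
    have u: "u \<in> D" "u \<notin> dn" "al u \<in> f_orbit th e" using Suc unfolding u_def by auto
    have lu: "lb (al u) = lb b"
    proof -
      have "lb u = lb (al b)" unfolding u_def using lab_s_pow bdn by simp
      then show ?thesis using lab_al_up[OF u(1,2)] lab_al_dn[OF bdn] by simp
    qed
    have su: "s u \<notin> dn"
    proof
      assume su: "s u \<in> dn"
      obtain z where z: "z \<in> dn" "m z = s u" using M.surj[OF su] by blast
      have "th z = al u" using up_then_dn(1)[OF u(1,2) su] z by (simp add: th_def)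
      then have "f_orbit th z = f_orbit th e"
        using TH.orbit_eq[OF z(1), of "al u"] f_orbit_step[of th z] TH.orbit_eq[OF assms u(3)] by simp
      then have "z \<in> f_orbit th e" using f_orbit_self by blast
      then have "lb b \<le> lb z" by (rule b(2))
      moreover have "lb z = lb u" using z lab_m[OF z(1)] u(1) by simp
      ultimately show False using lab_al_up[OF u(1,2)] lu by simp
    qed
    have sD: "s u \<in> D" using u by simp
    then have "al (s u) \<in> dn" using su al_dn_iff by blast
    moreover have "al u \<in> f_orbit th (al (s u))" using exc_orbit[OF up_up_exc[OF u(1,2) su]] .
    ultimately have "f_orbit th (al (s u)) = f_orbit th e"
      using TH.orbit_eq TH.orbit_eq[OF assms u(3)] by blast
    then have "al (s u) \<in> f_orbit th e" using f_orbit_self by blast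
    then show ?case using su sD unfolding u_def by simp
  qed
  then have "f_orbit s (al b) \<inter> dn = {}" unfolding f_orbit_def by blast
  moreover have "al b \<in> D" using bdn by simp
  ultimately show ?thesis using that[of "al b"] orb bdn by simp
qed

lemma card_local_mins: "card (local_mins D al s lb) = card (f_orbits th dn)"
proof -
  \<comment> \<open>The choice is harmless: by \<open>local_min_same_orbit\<close> all darts of a
    local minimum give the same orbit.\<close>
  define F where "F v = f_orbit th (al (SOME u. u \<in> v))" for v
  have F: "F (f_orbit s u) = f_orbit th (al u)" if "u \<in> D" "f_orbit s u \<inter> dn = {}" for u
    unfolding F_def using local_min_same_orbit[OF that] someI[of "\<lambda>x. x \<in> f_orbit s u", OF f_orbit_self] by blast
  have lm: "v \<in> local_mins D al s lb \<longleftrightarrow> (\<exists>u\<in>D. v = f_orbit s u \<and> f_orbit s u \<inter> dn = {})" for v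
    unfolding local_mins_eq f_orbits_def by auto
  have "inj_on F (local_mins D al s lb)"
  proof (rule inj_onI)
    fix v v' assume v: "v \<in> local_mins D al s lb" and v': "v' \<in> local_mins D al s lb"
      and eq: "F v = F v'"
    obtain u where u: "u \<in> D" "v = f_orbit s u" "f_orbit s u \<inter> dn = {}"
      using iffD1[OF lm v] by (elim bexE conjE)
    obtain u' where u': "u' \<in> D" "v' = f_orbit s u'" "f_orbit s u' \<inter> dn = {}"
      using iffD1[OF lm v'] by (elim bexE conjE)
    have orb: "f_orbit th (al u) = f_orbit th (al u')" using eq unfolding u(2) u'(2) F[OF u(1,3)] F[OF u'(1,3)] .
    \<comment> \<open>Of two distinct local minima in one orbit, each would have a label strictly
      below the other.\<close>
    have key: "y \<in> f_orbit s x \<or> lb x < lb y"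
      if "x \<in> D" "f_orbit s x \<inter> dn = {}" "y \<in> D" "f_orbit s y \<inter> dn = {}" "f_orbit th (al x) = f_orbit th (al y)" for x y
    proof -
      have "al y \<in> f_orbit th (al x)" unfolding that(5) by (rule f_orbit_self)
      then obtain n where n: "al y = (th ^^ n) (al x)" unfolding f_orbit_def by blast
      have "y \<notin> dn" using that(4) f_orbit_self[of y s] by blast
      from local_min_orbit_labels[OF that(1,2), of n] show ?thesis
      proof
        assume "(th ^^ n) (al x) \<in> al ` f_orbit s x"
        then obtain w where w: "w \<in> f_orbit s x" "al y = al w" unfolding n[symmetric] by blast
        then have "w \<in> D" using S.orbit_sub that(1) by blast
        then have "w = y" using w(2) AL.inj[OF that(3)] by blast
        then show ?thesis using \<open>w \<in> f_orbit s x\<close> by simp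
      next
        assume "lb x + 1 < lb ((th ^^ n) (al x))"
        then show ?thesis unfolding n[symmetric] using lab_al_up[OF that(3) \<open>y \<notin> dn\<close>] by simp
      qed
    qed
    have "u' \<in> f_orbit s u \<or> u \<in> f_orbit s u'"
      using key[OF u(1,3) u'(1,3) orb] key[OF u'(1,3) u(1,3) orb[symmetric]] by linarith
    then show "v = v'"
      unfolding u(2) u'(2) using S.orbit_eq[OF u(1), of u'] S.orbit_eq[OF u'(1), of u] by blast
  qed
  moreover have "F ` local_mins D al s lb = f_orbits th dn"
  proof (intro set_eqI iffI)
    fix o' assume "o' \<in> F ` local_mins D al s lb"
    then obtain v where v: "v \<in> local_mins D al s lb" "o' = F v" by blast
    then obtain u where u: "u \<in> D" "v = f_orbit s u" "f_orbit s u \<inter> dn = {}" using lm by blast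
    have o': "o' = f_orbit th (al u)" unfolding v(2) u(2) F[OF u(1,3)] ..
    have "u \<notin> dn" using u(3) f_orbit_self by blast
    then have "al u \<in> dn" using al_dn_iff u(1) by blast
    then show "o' \<in> f_orbits th dn" using o' unfolding f_orbits_def by blast
  next
    fix o' assume "o' \<in> f_orbits th dn"
    then obtain e where e: "e \<in> dn" "o' = f_orbit th e" unfolding f_orbits_def by blast
    obtain u where u: "u \<in> D" "f_orbit s u \<inter> dn = {}" "f_orbit th (al u) = f_orbit th e"
      using orbit_bottom[OF e(1)] .
    have "o' = F (f_orbit s u)" unfolding F[OF u(1,2)] u(3) e(2) ..
    moreover have "f_orbit s u \<in> local_mins D al s lb" using lm u(1,2) by blast
    ultimately show "o' \<in> F ` local_mins D al s lb" by blast
  qed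
  ultimately show ?thesis by (metis card_image)
qed

lemma n_faces_psi: "n_faces dn a m = card (local_mins D al s lb)"
proof -
  have "card (f_orbits th dn) = card (f_orbits (face_perm a m) dn)"
  proof (rule card_f_orbits_transport[where h = a])
    show "inj_on a dn" "a ` dn = dn" using A.bij by (auto simp: bij_betw_def)
  qed (simp_all add: face_perm_def th_def)
  then show ?thesis unfolding n_faces_def card_local_mins by simp
qed

section \<open>Euler characteristic and connectedness\<close>

lemma card_D: "card D = 2 * card dn"
proof -
  have "D = dn \<union> al ` dn"
  proof (intro set_eqI iffI)
    fix x assume x: "x \<in> D"
    show "x \<in> dn \<union> al ` dn"
    proof (cases "x \<in> dn")
      case False
      then have "al x \<in> dn" "x = al (al x)" using x al_dn_iff by auto
      then show ?thesis by blast
    qed simp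
  qed (auto)
  moreover have "dn \<inter> al ` dn = {}" using al_dn_iff by auto
  moreover have "card (al ` dn) = card dn"
    by (rule card_image) (meson AL.inj dn_D inj_onI)
  ultimately show ?thesis using card_Un_disjoint[of dn "al ` dn"] M.fin by simp
qed

lemma n_edges_Q: "2 * n_edges D al s = card D"
  unfolding n_edges_def using AL.card_orbits_involution al_neq by simp

lemma n_edges_psi: "2 * n_edges dn a m = card dn"
  unfolding n_edges_def using A.card_orbits_involution a_neq by simp

lemma n_faces_Q: "4 * n_faces D al s = card D"
  unfolding n_faces_def using PH.card_orbits face4 by simp

lemma n_vertices_Q: "n_vertices D al s = n_vertices dn a m + card (local_mins D al s lb)"
proof -
  define V where "V = {v \<in> f_orbits s D. v \<inter> dn \<noteq> {}}"
  have "f_orbits m dn = (\<lambda>v. v \<inter> dn) ` V"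
  proof (intro set_eqI iffI)
    fix w assume "w \<in> f_orbits m dn"
    then obtain d where d: "d \<in> dn" "w = f_orbit m d" unfolding f_orbits_def by blast
    then have "w = f_orbit s d \<inter> dn" using S.orbit_next_in[OF dn_sub] by simp
    moreover have "f_orbit s d \<in> V" unfolding V_def f_orbits_def using d f_orbit_self by auto
    ultimately show "w \<in> (\<lambda>v. v \<inter> dn) ` V" by blast
  next
    fix w assume "w \<in> (\<lambda>v. v \<inter> dn) ` V"
    then obtain x d where x: "x \<in> D" "w = f_orbit s x \<inter> dn" "d \<in> f_orbit s x" "d \<in> dn"
      unfolding V_def f_orbits_def by blast
    then have "w = f_orbit m d" using S.orbit_next_in[OF dn_sub x(4)] S.orbit_eq by simp
    then show "w \<in> f_orbits m dn" unfolding f_orbits_def using x by blast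
  qed
  moreover have "inj_on (\<lambda>v. v \<inter> dn) V"
  proof (rule inj_onI)
    fix v v' assume "v \<in> V" "v' \<in> V" "v \<inter> dn = v' \<inter> dn"
    then obtain x x' d where "x \<in> D" "x' \<in> D" "v = f_orbit s x" "v' = f_orbit s x'" "d \<in> v" "d \<in> v'"
      unfolding V_def f_orbits_def by blast
    then show "v = v'" using S.orbit_eq by metis
  qed
  ultimately have "n_vertices dn a m = card V" unfolding n_vertices_def by (simp add: card_image)
  moreover have "f_orbits s D = V \<union> local_mins D al s lb" "V \<inter> local_mins D al s lb = {}"
    unfolding V_def local_mins_eq by blast+
  ultimately show ?thesis unfolding n_vertices_def
    by (metis S.orbits_fin card_Un_disjoint finite_Un)
qed

text \<open>With n = \<open>card dn\<close>, the quadrangulation has n edges and n/2 faces, and the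
  map has n/2 edges. The vertices lost, its local minima, are regained as faces.\<close>

lemma euler_psi:
  "int (n_vertices D al s) - int (n_edges D al s) + int (n_faces D al s)
   = int (n_vertices dn a m) - int (n_edges dn a m) + int (n_faces dn a m)"
  using n_vertices_Q n_edges_Q n_edges_psi n_faces_Q n_faces_psi card_D by linarith

lemma n_edges_psi_faces: "n_edges dn a m = n_faces D al s"
  using n_edges_psi n_faces_Q card_D by linarith

text \<open>Both directions matter: one makes \<open>psi Q\<close> a map, the other makes the
  inverse image a quadrangulation.\<close>

lemma connected_psi:
  "(\<forall>x\<in>dn. \<forall>y\<in>dn. (x, y) \<in> ({(d, a d) | d. d \<in> dn} \<union> {(d, m d) | d. d \<in> dn})\<^sup>*) \<longleftrightarrow>
   (\<forall>x\<in>D. \<forall>y\<in>D. (x, y) \<in> ({(d, al d) | d. d \<in> D} \<union> {(d, s d) | d. d \<in> D})\<^sup>*)"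
  (is "(\<forall>x\<in>dn. \<forall>y\<in>dn. (x, y) \<in> ?M\<^sup>*) \<longleftrightarrow> (\<forall>x\<in>D. \<forall>y\<in>D. (x, y) \<in> ?Q\<^sup>*)")
proof
  assume L: "\<forall>x\<in>dn. \<forall>y\<in>dn. (x, y) \<in> ?M\<^sup>*"
  have Qal: "(d, al d) \<in> ?Q\<^sup>*" and Qs: "(d, s d) \<in> ?Q\<^sup>*" if "d \<in> D" for d using that by blast+
  have Qph: "(d, ph d) \<in> ?Q\<^sup>*" if "d \<in> D" for d
    unfolding ph using Qal[OF that] Qs[OF al_D[OF that]] by (rule rtrancl_trans)
  have "?M \<subseteq> ?Q\<^sup>*"
  proof
    fix p assume "p \<in> ?M"
    then obtain d where d: "d \<in> dn" "p = (d, a d) \<or> p = (d, m d)" by blast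
    have "(d, m d) \<in> ?Q\<^sup>*"
    proof (rule S.orbit_rtrancl[OF Qs])
      obtain k where "m d = (s ^^ k) d" by (rule S.next_in_obtain[OF d(1) dn_sub])
      then show "m d \<in> f_orbit s d" using f_orbit_pow by metis
    qed (use d in simp_all)
    moreover have "(d, a d) \<in> ?Q\<^sup>*"
    proof (rule PH.orbit_rtrancl[OF Qph])
      show "a d \<in> f_orbit ph d"
        using f_orbit_pow[of 1 ph d] f_orbit_pow[of 2 ph d] f_orbit_pow[of 3 ph d]
        by (cases rule: a_cases[OF d(1)]) (simp_all add: numeral_eq_Suc)
    qed (use d in simp_all)
    ultimately show "p \<in> ?Q\<^sup>*" using d by blast
  qed
  then have MQ: "?M\<^sup>* \<subseteq> ?Q\<^sup>*" by (rule rtrancl_subset_rtrancl)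
  show "\<forall>x\<in>D. \<forall>y\<in>D. (x, y) \<in> ?Q\<^sup>*"
  proof (intro ballI)
    fix x y assume xy: "x \<in> D" "y \<in> D"
    have "\<exists>x'\<in>dn. (x, x') \<in> ?Q\<^sup>*"
    proof (cases "x \<in> dn")
      case False
      then have "al x \<in> dn" using al_dn_iff xy by blast
      then show ?thesis using Qal xy by blast
    qed blast
    moreover have "\<exists>y'\<in>dn. (y', y) \<in> ?Q\<^sup>*"
    proof (cases "y \<in> dn")
      case False
      then have "al y \<in> dn" using al_dn_iff xy by blast
      moreover have "(al y, y) \<in> ?Q\<^sup>*" using Qal[of "al y"] xy by simp
      ultimately show ?thesis by blast
    qed blast
    ultimately obtain x' y' where *: "x' \<in> dn" "y' \<in> dn" "(x, x') \<in> ?Q\<^sup>*" "(y', y) \<in> ?Q\<^sup>*" by blast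
    have "(x', y') \<in> ?Q\<^sup>*" using L MQ * by blast
    then show "(x, y) \<in> ?Q\<^sup>*" using * by (meson rtrancl_trans)
  qed
next
  assume R: "\<forall>x\<in>D. \<forall>y\<in>D. (x, y) \<in> ?Q\<^sup>*"
  \<comment> \<open>Each edge is represented by its descending dart. Then \<open>al\<close> acts
    trivially, and a rotation step becomes a step of the map or a stretch of an orbit of
    \<open>th\<close>, by the excursion lemmas.\<close>
  define \<kappa> where "\<kappa> x = (if x \<in> dn then x else al x)" for x
  have Ma: "(d, a d) \<in> ?M\<^sup>*" and Mm: "(d, m d) \<in> ?M\<^sup>*" if "d \<in> dn" for d using that by blast+
  have Mth: "(d, th d) \<in> ?M\<^sup>*" if "d \<in> dn" for d
    using rtrancl_trans[OF Mm[OF that] Ma[OF M.in_D[OF that]]] by (simp add: th_def)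
  have orb: "(x, y) \<in> ?M\<^sup>*" if "x \<in> dn" "y \<in> f_orbit th x" for x y
    using TH.orbit_rtrancl[OF Mth that] .
  have al_step: "\<kappa> (al x) = \<kappa> x" if "x \<in> D" for x
    using that al_dn_iff[OF that] by (simp add: \<kappa>_def)
  have s_step: "(\<kappa> x, \<kappa> (s x)) \<in> ?M\<^sup>*" if x: "x \<in> D" for x
  proof (cases "x \<in> dn"; cases "s x \<in> dn")
    assume *: "x \<in> dn" "s x \<in> dn"
    then show ?thesis using Mm[OF *(1)] dn_then_dn(1)[OF *] by (simp add: \<kappa>_def)
  next
    assume *: "x \<in> dn" "s x \<notin> dn"
    have w: "al (s x) \<in> dn" using next_level(5)[OF *] .
    have "th (al (s x)) \<in> f_orbit th x" using exc_orbit[OF exc_dn_up[OF *]] .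
    then have "f_orbit th (al (s x)) = f_orbit th x"
      using TH.orbit_eq[OF w f_orbit_step] TH.orbit_eq[OF *(1)] by simp
    then have "al (s x) \<in> f_orbit th x" using f_orbit_self by blast
    then show ?thesis using orb * by (simp add: \<kappa>_def)
  next
    assume *: "x \<notin> dn" "s x \<in> dn"
    then have "a (al x) = s x"
      using up_then_dn(1)[OF x *] a_a[OF *(2)] by simp
    then show ?thesis using Ma[of "al x"] * x al_dn_iff by (simp add: \<kappa>_def)
  next
    assume *: "x \<notin> dn" "s x \<notin> dn"
    have "al (s x) \<in> dn" "al x \<in> dn" using * x al_dn_iff by auto
    moreover have "al x \<in> f_orbit th (al (s x))" using exc_orbit[OF up_up_exc[OF x *]] .
    ultimately have "(al x, al (s x)) \<in> ?M\<^sup>*" using orb TH.orbit_sym by blast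
    then show ?thesis using * by (simp add: \<kappa>_def)
  qed
  have path: "y \<in> D \<and> (\<kappa> x, \<kappa> y) \<in> ?M\<^sup>*" if "(x, y) \<in> ?Q\<^sup>*" "x \<in> D" for x y
    using that
  proof (induction rule: rtrancl_induct)
    case (step y z)
    then have y: "y \<in> D" "(\<kappa> x, \<kappa> y) \<in> ?M\<^sup>*" by auto
    have "(\<kappa> y, \<kappa> z) \<in> ?M\<^sup>*" using step.hyps(2) al_step s_step by auto
    then show ?case using y rtrancl_trans step.hyps(2) by auto
  qed simp
  show "\<forall>x\<in>dn. \<forall>y\<in>dn. (x, y) \<in> ?M\<^sup>*"
  proof (intro ballI)
    fix x y assume "x \<in> dn" "y \<in> dn"
    then show "(x, y) \<in> ?M\<^sup>*" using path[of x y] R by (simp add: \<kappa>_def)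
  qed
qed

lemma dn_ne: "dn \<noteq> {}"
  using ne al_dn_iff by fastforce

lemma planar_psi: "is_planar_map dn a m \<longleftrightarrow> is_planar_map D al s"
proof -
  have *: "\<forall>d\<in>dn. a d \<in> dn \<and> a d \<noteq> d \<and> a (a d) = d" using a_neq by simp
  show ?thesis
    unfolding is_planar_map_def connected_psi euler_psi
    using fin ne alpha sigma_bij M.fin dn_ne * M.bij by blast
qed

section \<open>Local maxima, extremal labels and the root\<close>

lemma local_maxs_eq: "local_maxs D al s lb = {v \<in> f_orbits s D. v \<subseteq> dn}"
proof -
  have "(\<forall>d\<in>v. lb (al d) \<le> lb d) \<longleftrightarrow> v \<subseteq> dn" if "v \<in> f_orbits s D" for v
  proof -
    have v: "v \<subseteq> D" using that S.orbit_sub unfolding f_orbits_def by blast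
    have "lb (al d) \<le> lb d \<longleftrightarrow> d \<in> dn" if "d \<in> v" for d
      using lab_al_dn[of d] lab_al_up[of d] v that by (cases "d \<in> dn") auto
    then show ?thesis by blast
  qed
  then show ?thesis unfolding local_maxs_def by blast
qed

text \<open>If all darts descend, \<open>dn_then_dn\<close> shows that no new edge ascends.
  Conversely, an ascending dart following a descending \<open>y\<close> makes the new edge at
  \<open>m y\<close> ascend, by \<open>dn_then_up\<close>.\<close>

lemma local_max_iff:
  assumes d: "d \<in> dn"
  shows "f_orbit s d \<subseteq> dn \<longleftrightarrow> (\<forall>x\<in>f_orbit m d. lb (a x) \<le> lb x)"
proof
  assume L: "f_orbit s d \<subseteq> dn"
  show "\<forall>x\<in>f_orbit m d. lb (a x) \<le> lb x"
  proof
    fix x assume "x \<in> f_orbit m d"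
    then have x: "x \<in> f_orbit s d" "x \<in> dn" using S.orbit_next_in[OF dn_sub d] by auto
    obtain y where y: "y \<in> D" "s y = x" using S.surj x(2) dn_D by blast
    have "x \<in> f_orbit s y" using f_orbit_step y by metis
    then have "f_orbit s y = f_orbit s d" using S.orbit_eq[OF y(1)] S.orbit_eq[OF dn_D[OF d] x(1)] by simp
    then have ydn: "y \<in> dn" using L f_orbit_self by blast
    have "m y = x" "lb (th y) \<le> lb y" using dn_then_dn[OF ydn] y x by auto
    then show "lb (a x) \<le> lb x" using lab_m[OF ydn] by (simp add: th_def)
  qed
next
  assume R: "\<forall>x\<in>f_orbit m d. lb (a x) \<le> lb x"
  have "(s ^^ i) d \<in> dn" for i
  proof (induction i)
    case (Suc i)
    define y where "y = (s ^^ i) d"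
    have y: "y \<in> dn" using Suc y_def by simp
    have "y \<in> f_orbit m d"
      using S.orbit_next_in[OF dn_sub d] y f_orbit_pow unfolding y_def by blast
    then have my: "m y \<in> f_orbit m d" using M.orbit_eq[OF d] f_orbit_step by blast
    show ?case
    proof (rule ccontr)
      assume "(s ^^ Suc i) d \<notin> dn"
      then have "s y \<notin> dn" by (simp add: y_def)
      then have "lb (th y) = lb y + 1" by (rule dn_then_up[OF y])
      then show False using R my lab_m[OF y] by (auto simp: th_def)
    qed
  qed (simp add: d)
  then show "f_orbit s d \<subseteq> dn" unfolding f_orbit_def by blast
qed

text \<open>At a local maximum every dart descends, so its \<open>s\<close>-orbit and
  \<open>m\<close>-orbit coincide as sets of darts.\<close>

lemma local_maxs_psi: "local_maxs dn a m lb = local_maxs D al s lb"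
proof (intro set_eqI iffI)
  fix v assume "v \<in> local_maxs dn a m lb"
  then obtain d where d: "d \<in> dn" "v = f_orbit m d" "\<forall>x\<in>f_orbit m d. lb (a x) \<le> lb x"
    unfolding local_maxs_def f_orbits_def by auto
  then have "f_orbit s d \<subseteq> dn" using local_max_iff by blast
  moreover from this have "v = f_orbit s d" using S.orbit_next_in[OF dn_sub d(1)] d(2) by blast
  ultimately show "v \<in> local_maxs D al s lb" unfolding local_maxs_eq f_orbits_def using d(1) by auto
next
  fix v assume "v \<in> local_maxs D al s lb"
  then obtain d where d: "d \<in> D" "v = f_orbit s d" "f_orbit s d \<subseteq> dn"
    unfolding local_maxs_eq f_orbits_def by auto
  then have ddn: "d \<in> dn" using f_orbit_self by blast
  then have "v = f_orbit m d" using S.orbit_next_in[OF dn_sub ddn] d by blast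
  then show "v \<in> local_maxs dn a m lb"
    using local_max_iff[OF ddn] d(3) ddn unfolding local_maxs_def f_orbits_def by blast
qed

lemma local_maxs_orbits:
  "local_maxs D al s lb = {f_orbit s d | d. d \<in> dn \<and> f_orbit m d \<in> local_maxs dn a m lb}"
proof (intro set_eqI iffI)
  fix v assume v: "v \<in> local_maxs D al s lb"
  then obtain d where d: "d \<in> D" "v = f_orbit s d" "f_orbit s d \<subseteq> dn"
    unfolding local_maxs_eq f_orbits_def by auto
  then have ddn: "d \<in> dn" using f_orbit_self by blast
  then have "v = f_orbit m d" using S.orbit_next_in[OF dn_sub ddn] d by blast
  then show "v \<in> {f_orbit s d | d. d \<in> dn \<and> f_orbit m d \<in> local_maxs dn a m lb}"
    using v d(2) ddn unfolding local_maxs_psi by blast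
next
  fix v assume "v \<in> {f_orbit s d | d. d \<in> dn \<and> f_orbit m d \<in> local_maxs dn a m lb}"
  then obtain d where d: "v = f_orbit s d" "d \<in> dn" "f_orbit m d \<in> local_maxs dn a m lb" by blast
  then have "\<forall>x\<in>f_orbit m d. lb (a x) \<le> lb x" unfolding local_maxs_def by blast
  then show "v \<in> local_maxs D al s lb"
    using local_max_iff[OF d(2)] d unfolding local_maxs_eq f_orbits_def by auto
qed

lemma Max_lab_psi: "Max (lb ` dn) = Max (lb ` D)"
proof (rule Max_eqI[symmetric])
  show "Max (lb ` dn) \<in> lb ` D" using Max_in[of "lb ` dn"] M.fin dn_ne dn_sub by fastforce
  fix t assume "t \<in> lb ` D"
  then obtain x where x: "x \<in> D" "t = lb x" by blast
  show "t \<le> Max (lb ` dn)"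
  proof (cases "x \<in> dn")
    case False
    then have "al x \<in> dn" "lb (al x) = lb x + 1" using x al_dn_iff lab_al_up by auto
    then have "lb x + 1 \<le> Max (lb ` dn)"
      using Max_ge[OF finite_imageI[OF M.fin] imageI[OF \<open>al x \<in> dn\<close>], of lb] by simp
    then show ?thesis using x by simp
  qed (use x M.fin in simp)
qed (use fin in simp)

text \<open>A vertex of smallest label has no descending dart and disappears; its neighbours, one
  label higher, survive.\<close>

lemma Min_lab_psi: "Min (lb ` dn) = Min (lb ` D) + 1"
proof (rule Min_eqI)
  have "Min (lb ` D) \<in> lb ` D" using fin ne by (intro Min_in) auto
  then obtain x where x: "x \<in> D" "Min (lb ` D) = lb x" by blast
  have min: "lb x \<le> lb y" if "y \<in> D" for y using x(2)[symmetric] fin that by simp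
  have "x \<notin> dn" using min[of "al x"] x lab_al_dn[of x] by fastforce
  then have "al x \<in> dn" "lb (al x) = lb x + 1" using x al_dn_iff lab_al_up by auto
  then show "Min (lb ` D) + 1 \<in> lb ` dn" unfolding x(2) by force
  fix t assume "t \<in> lb ` dn"
  then obtain y where y: "y \<in> dn" "t = lb y" by blast
  then have "lb x \<le> lb (al y)" using min by simp
  then show "Min (lb ` D) + 1 \<le> t" unfolding x(2) using lab_al_dn[OF y(1)] y(2) by simp
qed (use M.fin in simp)

lemma psi_sel [simp]:
  "mD (psi Q) = dn" "malpha (psi Q) = a" "msigma (psi Q) = m" "mlab (psi Q) = lb"
  by (simp_all add: psi_def sch_darts Let_def)

text \<open>The new dart named \<open>d\<close> lies inside the sector that ends at the dart
  \<open>d\<close>, hence before the root edge in the rotation. The root edge therefore points into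
  the sector that ends at \<open>m d\<close>, not the one at \<open>d\<close>.\<close>

lemma root_obtain:
  assumes "r \<in> D" "qroot Q = {r, al r}"
  obtains d where "d \<in> dn" "qroot Q = {d, al d}" "mroot (psi Q) = m d"
proof -
  obtain d where d: "d \<in> dn" "qroot Q = {d, al d}"
  proof (cases "r \<in> dn")
    case True then show ?thesis using that assms by blast
  next
    case False
    then have "al r \<in> dn" "al (al r) = r" using assms al_dn_iff by auto
    then show ?thesis using that[of "al r"] assms by auto
  qed
  have "(THE d. d \<in> qroot Q \<and> lb (al d) < lb d) = d"
    unfolding d(2) using lab_al_dn[OF d(1)] d(1) by (intro the_equality) auto
  then have "mroot (psi Q) = m d" by (simp add: psi_def sch_darts Let_def)
  then show ?thesis using that d by blast
qed

end

lemma lquad_labelled_quads: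
  assumes "is_lquad Q"
  shows "labelled_quads Q" "is_planar_map (qD Q) (qalpha Q) (qsigma Q)"
    "\<exists>r\<in>qD Q. qroot Q = {r, qalpha Q r}"
  using assms unfolding is_lquad_def is_quadrangulation_def is_planar_map_def
  by (auto intro!: labelled_quads.intro)

lemma is_lmap_psi:
  assumes "is_lquad Q"
  shows "is_lmap (psi Q)"
proof -
  interpret labelled_quads Q using lquad_labelled_quads assms by blast
  obtain d where d: "d \<in> dn" "mroot (psi Q) = m d"
    using root_obtain lquad_labelled_quads(3)[OF assms] by metis
  show ?thesis
    unfolding is_lmap_def using lquad_labelled_quads(2)[OF assms] planar_psi lab_a d by simp
qed

section \<open>Isomorphisms\<close>

lemma funpow_transport:
  assumes "\<And>d. d \<in> D \<Longrightarrow> f d \<in> D" "\<And>d. d \<in> D \<Longrightarrow> h (f d) = f' (h d)" "x \<in> D"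
  shows "(f ^^ n) x \<in> D \<and> h ((f ^^ n) x) = (f' ^^ n) (h x)"
  using assms by (induction n) auto

lemma next_in_transport:
  assumes "\<And>d. d \<in> D \<Longrightarrow> f d \<in> D" "\<And>d. d \<in> D \<Longrightarrow> h (f d) = f' (h d)"
    and "\<And>d. d \<in> D \<Longrightarrow> h d \<in> S' \<longleftrightarrow> d \<in> S" and "x \<in> D"
  shows "h (next_in f S x) = next_in f' S' (h x)"
proof -
  have pow: "(f ^^ n) x \<in> D" "h ((f ^^ n) x) = (f' ^^ n) (h x)" for n
    using funpow_transport[of D f h f' x n] assms(1,2,4) by auto
  have "(f' ^^ k) (h x) \<in> S' \<longleftrightarrow> (f ^^ k) x \<in> S" for k
    using assms(3)[OF pow(1)[of k]] unfolding pow(2) .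
  then show ?thesis unfolding next_in_def using pow(2) by simp
qed

lemma excursion_transport:
  assumes "\<And>d. d \<in> D \<Longrightarrow> f d \<in> D" "\<And>d. d \<in> D \<Longrightarrow> h (f d) = f' (h d)"
    and "\<And>d. d \<in> D \<Longrightarrow> l' (h d) = l d" and "e \<in> D" and "excursion f l e x"
  shows "excursion f' l' (h e) (h x)"
proof -
  have pow: "(f ^^ n) e \<in> D" "h ((f ^^ n) e) = (f' ^^ n) (h e)" for n
    using funpow_transport[of D f h f' e n] assms(1,2,4) by auto
  obtain n where n: "n > 0" "(f ^^ n) e = x" "l x = l e" "\<And>i. 0 < i \<Longrightarrow> i < n \<Longrightarrow> l e < l ((f ^^ i) e)"
    using assms(5) unfolding excursion_def by blast
  have lab: "l' ((f' ^^ i) (h e)) = l ((f ^^ i) e)" for i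
    using assms(3)[OF pow(1)[of i]] unfolding pow(2) .
  have "(f' ^^ n) (h e) = h x" using pow(2)[of n] n(2) by simp
  moreover have "l' (h x) = l' (h e)" using lab[of n] lab[of 0] n(2,3) pow(2)[of n] by simp
  ultimately show ?thesis
    unfolding excursion_def using n(1,4) lab lab[of 0] by auto
qed

lemma excursion_right_unique:
  assumes "excursion f l e x" "excursion f l e y"
  shows "x = y"
proof -
  obtain n where n: "n > 0" "(f ^^ n) e = x" "l x = l e" "\<And>i. 0 < i \<Longrightarrow> i < n \<Longrightarrow> l e < l ((f ^^ i) e)"
    using assms(1) unfolding excursion_def by blast
  obtain k where k: "k > 0" "(f ^^ k) e = y" "l y = l e" "\<And>i. 0 < i \<Longrightarrow> i < k \<Longrightarrow> l e < l ((f ^^ i) e)"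
    using assms(2) unfolding excursion_def by blast
  have "\<not> n < k" using k(4)[of n] n(1,2,3) by auto
  moreover have "\<not> k < n" using n(4)[of k] k(1,2,3) by auto
  ultimately have "n = k" by simp
  then show ?thesis using n(2) k(2) by simp
qed

text \<open>Of two excursions of different length ending at \<open>x\<close>, the shorter would
  start inside the longer, strictly above its level, although both start at the label of
  \<open>x\<close>.\<close>

lemma (in finite_perm) excursion_left_unique:
  assumes "excursion f l e x" "excursion f l e' x" "e \<in> D" "e' \<in> D"
  shows "e = e'"
proof -
  have key: "e = e'"
    if e: "e \<in> D" "e' \<in> D" "(f ^^ n) e = x" "l x = l e" "(f ^^ k) e' = x" "l x = l e'"
      "\<And>i. 0 < i \<Longrightarrow> i < k \<Longrightarrow> l e' < l ((f ^^ i) e')" "0 < n" "n \<le> k" for e e' n k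
  proof (cases "n = k")
    case True
    then show ?thesis using pow_inj[OF e(1,2), of n] e(3,5) by simp
  next
    case False
    have "e = (f ^^ (k - n)) e'" using pow_cancel[OF e(1,2) _ e(9)] e(3,5) by simp
    moreover have "0 < k - n" "k - n < k" using False e(8,9) by auto
    ultimately show ?thesis using e(7)[of "k - n"] e(4,6) by simp
  qed
  obtain n where n: "n > 0" "(f ^^ n) e = x" "l x = l e" "\<And>i. 0 < i \<Longrightarrow> i < n \<Longrightarrow> l e < l ((f ^^ i) e)"
    using assms(1) unfolding excursion_def by blast
  obtain k where k: "k > 0" "(f ^^ k) e' = x" "l x = l e'" "\<And>i. 0 < i \<Longrightarrow> i < k \<Longrightarrow> l e' < l ((f ^^ i) e')"
    using assms(2) unfolding excursion_def by blast
  show ?thesis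
  proof (cases "n \<le> k")
    case True
    show ?thesis using key[OF assms(3,4) n(2,3) k(2,3) k(4) n(1) True] .
  next
    case False
    then show ?thesis using key[OF assms(4,3) k(2,3) n(2,3) n(4) k(1)] by simp
  qed
qed

context labelled_quads
begin

lemma s_dn_iff:
  assumes "e \<in> dn"
  shows "s e \<in> dn \<longleftrightarrow> lb (th e) \<le> lb e"
proof (cases "s e \<in> dn")
  case True
  then show ?thesis using dn_then_dn(2)[OF assms True] by simp
next
  case False
  have "lb (th e) = lb e + 1" by (rule dn_then_up[OF assms False])
  then show ?thesis using False by simp
qed

lemma bij_al_up: "bij_betw al (D - dn) dn"
  by (rule bij_betw_byWitness[where f' = al]) (auto simp: al_dn_iff)

lemma bij_al_dn: "bij_betw al dn (D - dn)"
  by (rule bij_betw_byWitness[where f' = al]) (auto simp: al_dn_iff)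

end

lemma psi_respects_iso:
  assumes "is_lquad Q" "is_lquad Q'" "lquad_iso Q Q'"
  shows "lmap_iso (psi Q) (psi Q')"
proof -
  interpret P: labelled_quads Q using lquad_labelled_quads assms by blast
  interpret P': labelled_quads Q' using lquad_labelled_quads assms by blast
  obtain h where h: "bij_betw h P.D P'.D" "h ` qroot Q = qroot Q'"
    and hal: "\<And>d. d \<in> P.D \<Longrightarrow> h (P.al d) = P'.al (h d)"
    and hs: "\<And>d. d \<in> P.D \<Longrightarrow> h (P.s d) = P'.s (h d)"
    and hlb: "\<And>d. d \<in> P.D \<Longrightarrow> P'.lb (h d) = P.lb d"
    using assms(3) unfolding lquad_iso_def by blast
  have hD: "h d \<in> P'.D" if "d \<in> P.D" for d using h(1) that bij_betwE by blast
  have hph: "h (P.ph d) = P'.ph (h d)" if "d \<in> P.D" for d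
    unfolding P.ph P'.ph using that hal hs by simp
  have hdn: "h d \<in> P'.dn \<longleftrightarrow> d \<in> P.dn" if "d \<in> P.D" for d
    using that hD hlb hlb[OF P.al_D[OF that]] hal[OF that]
    unfolding P.dn_def P'.dn_def by simp
  have bij: "bij_betw h P.dn P'.dn"
  proof -
    have "h ` P.dn = P'.dn"
    proof (intro set_eqI iffI)
      fix y assume y: "y \<in> P'.dn"
      then have "y \<in> h ` P.D" using h(1) P'.dn_D by (simp add: bij_betw_def)
      then show "y \<in> h ` P.dn" using y hdn by blast
    qed (use hdn P.dn_D in blast)
    moreover have "inj_on h P.dn" using h(1) P.dn_sub by (meson bij_betw_def inj_on_subset)
    ultimately show ?thesis by (simp add: bij_betw_def)
  qed
  have ha: "h (P.a c) = P'.a (h c)" if c: "c \<in> P.dn" for c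
  proof -
    have D: "c \<in> P.D" "P.ph c \<in> P.D" "P.ph (P.ph c) \<in> P.D" "P.ph (P.ph (P.ph c)) \<in> P.D"
      using c by auto
    have c': "h c \<in> P'.dn" using hdn[OF D(1)] c by simp
    have p: "P'.ph (h c) = h (P.ph c)" "P'.ph (h (P.ph c)) = h (P.ph (P.ph c))"
      "P'.ph (h (P.ph (P.ph c))) = h (P.ph (P.ph (P.ph c)))"
      using hph D by simp_all
    show ?thesis
      using c
    proof (cases rule: P.a_cases)
      case conf
      then show ?thesis using P'.a_conf[OF c'] hlb D unfolding p by simp
    next
      case top
      then show ?thesis using P'.a_top[OF c'] hlb D unfolding p by simp
    next
      case bot
      then show ?thesis using P'.a_bot[OF c'] hlb D unfolding p by simp
    qed
  qed
  have hm: "h (P.m c) = P'.m (h c)" if "c \<in> P.D" for c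
    by (rule next_in_transport[of P.D]) (use hs hdn that in auto)
  obtain d where d: "d \<in> P.dn" "qroot Q = {d, P.al d}" "mroot (psi Q) = P.m d"
    using P.root_obtain lquad_labelled_quads(3)[OF assms(1)] by metis
  obtain d' where d': "d' \<in> P'.dn" "qroot Q' = {d', P'.al d'}" "mroot (psi Q') = P'.m d'"
    using P'.root_obtain lquad_labelled_quads(3)[OF assms(2)] by metis
  have "h d \<in> qroot Q'" using h(2) d(2) by blast
  moreover have "h d \<in> P'.dn" "P'.al d' \<notin> P'.dn" using hdn d(1) d'(1) P'.al_dn_iff by auto
  ultimately have "h d = d'" unfolding d'(2) by auto
  then have "h (mroot (psi Q)) = mroot (psi Q')" unfolding d(3) d'(3) using hm d(1) by simp
  then show ?thesis
    unfolding lmap_iso_def using bij ha hm hlb by (intro exI[of _ h]) simp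
qed

section \<open>Recovering the quadrangulation from its map\<close>

lemma psi_reflects_iso:
  assumes "is_lquad Q" "is_lquad Q'" "lmap_iso (psi Q) (psi Q')"
  shows "lquad_iso Q Q'"
proof -
  interpret P: labelled_quads Q using lquad_labelled_quads assms by blast
  interpret P': labelled_quads Q' using lquad_labelled_quads assms by blast
  obtain g where g: "bij_betw g P.dn P'.dn" "g (mroot (psi Q)) = mroot (psi Q')"
    and ga: "\<And>d. d \<in> P.dn \<Longrightarrow> g (P.a d) = P'.a (g d)"
    and gm: "\<And>d. d \<in> P.dn \<Longrightarrow> g (P.m d) = P'.m (g d)"
    and glb: "\<And>d. d \<in> P.dn \<Longrightarrow> P'.lb (g d) = P.lb d"
    using assms(3) unfolding lmap_iso_def by auto
  have gdn: "g d \<in> P'.dn" if "d \<in> P.dn" for d using g(1) that bij_betwE by blast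
  have gth: "g (P.th d) = P'.th (g d)" if "d \<in> P.dn" for d
    using ga[of "P.m d"] gm[of d] that by (simp add: P.th_def P'.th_def)
  have gexc: "P'.exc (g e) (g x)" if "e \<in> P.dn" "P.exc e x" for e x
    by (rule excursion_transport[of P.dn P.th]) (use gth glb that in auto)
  \<comment> \<open>Commuting with the edge involutions leaves no other choice on ascending
    darts.\<close>
  define h where "h x = (if x \<in> P.dn then g x else P'.al (g (P.al x)))" for x
  have hdn: "h x = g x" if "x \<in> P.dn" for x using that by (simp add: h_def)
  have hup: "h x = P'.al (g (P.al x))" if "x \<notin> P.dn" for x using that by (simp add: h_def)
  have bij: "bij_betw h P.D P'.D"
  proof -
    have "bij_betw h P.dn P'.dn"
      using g(1) by (subst bij_betw_cong[of _ h g]) (simp_all add: hdn)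
    moreover have "bij_betw h (P.D - P.dn) (P'.D - P'.dn)"
      using bij_betw_trans[OF bij_betw_trans[OF P.bij_al_up g(1)] P'.bij_al_dn]
      by (subst bij_betw_cong[of _ h "P'.al \<circ> (g \<circ> P.al)"]) (simp_all add: hup)
    ultimately have "bij_betw h (P.dn \<union> (P.D - P.dn)) (P'.dn \<union> (P'.D - P'.dn))"
      by (rule bij_betw_combine) blast
    moreover have "P.dn \<union> (P.D - P.dn) = P.D" "P'.dn \<union> (P'.D - P'.dn) = P'.D"
      using P.dn_sub P'.dn_sub by blast+
    ultimately show ?thesis by simp
  qed
  have hal: "h (P.al x) = P'.al (h x)" if x: "x \<in> P.D" for x
  proof (cases "x \<in> P.dn")
    case True
    then have "P.al x \<notin> P.dn" using P.al_dn_iff x by blast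
    then show ?thesis using True x by (simp add: hdn hup)
  next
    case False
    then have "P.al x \<in> P.dn" using P.al_dn_iff x by blast
    moreover from this have "P'.al (P'.al (g (P.al x))) = g (P.al x)" using gdn by simp
    ultimately show ?thesis using False by (simp add: hdn hup)
  qed
  have hlb: "P'.lb (h x) = P.lb x" if x: "x \<in> P.D" for x
  proof (cases "x \<in> P.dn")
    case True
    then show ?thesis by (simp add: hdn glb)
  next
    case False
    then have "P.al x \<in> P.dn" using P.al_dn_iff x by blast
    then have "P'.lb (P'.al (g (P.al x))) = P.lb (P.al x) - 1" using P'.lab_al_dn gdn glb by simp
    then show ?thesis using False P.lab_al_up[OF x False] by (simp add: hup)
  qed
  \<comment> \<open>Labels, \<open>a\<close> and \<open>th\<close> decide whether
    \<open>P.s x\<close> descends. If it does, \<open>m\<close> or \<open>a\<close> gives it; if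
    not, its reverse is the unique one fitting an excursion, on the right for a descending
    \<open>x\<close> and on the left for an ascending \<open>x\<close>.\<close>
  have hs: "h (P.s x) = P'.s (h x)" if x: "x \<in> P.D" for x
  proof (cases "x \<in> P.dn")
    case True
    then have gx: "g x \<in> P'.dn" "P'.s (g x) \<in> P'.dn \<longleftrightarrow> P.s x \<in> P.dn"
      using gdn P.s_dn_iff P'.s_dn_iff glb[OF True] glb[of "P.th x"] gth[OF True] by auto
    show ?thesis
    proof (cases "P.s x \<in> P.dn")
      case sx: True
      have "g (P.s x) = P'.s (g x)"
        using P.dn_then_dn(1)[OF True sx] P'.dn_then_dn(1)[OF gx(1)] gx(2) sx gm[OF True] by simp
      then show ?thesis using True sx by (simp add: hdn)
    next
      case sx: False
      define w w' where "w = P.al (P.s x)" and "w' = P'.al (P'.s (g x))"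
      have w: "w \<in> P.dn" "P.exc x (P.th w)"
        unfolding w_def using P.next_level(5)[OF True sx] P.exc_dn_up[OF True sx] by auto
      have sx': "P'.s (g x) \<notin> P'.dn" using gx(2) sx by simp
      have w': "w' \<in> P'.dn" "P'.exc (g x) (P'.th w')"
        unfolding w'_def using P'.next_level(5)[OF gx(1) sx'] P'.exc_dn_up[OF gx(1) sx'] by auto
      have "P'.exc (g x) (P'.th (g w))" using gexc[OF True w(2)] gth[OF w(1)] by simp
      then have "P'.th (g w) = P'.th w'" using w'(2) excursion_right_unique by blast
      then have "g w = w'" using P'.TH.inj gdn w(1) w'(1) by blast
      then have "P'.al (g w) = P'.s (g x)" unfolding w'_def using gx(1) by simp
      then show ?thesis using sx True by (simp add: hdn hup w_def)
    qed
  next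
    case False
    define y where "y = P.al x"
    have y: "y \<in> P.dn" "P.ph y = P.s x" unfolding y_def P.ph using P.al_dn_iff x False by auto
    have gy: "g y \<in> P'.dn" using gdn y(1) .
    have hx: "P'.s (h x) = P'.ph (g y)" using False by (simp add: hup P'.ph y_def)
    have crit: "P'.ph (g y) \<in> P'.dn \<longleftrightarrow> P.s x \<in> P.dn"
      using P'.al_s_dn_iff(1)[OF gy] P.al_s_dn_iff(1)[OF y(1)] y ga[OF y(1)] glb[OF y(1)]
        glb[of "P.a y"] by simp
    show ?thesis
    proof (cases "P.s x \<in> P.dn")
      case sx: True
      have "P.s x = P.a y" using P.al_s_dn_iff(2)[OF y(1)] y(2) sx by simp
      moreover have "P'.ph (g y) = P'.a (g y)" using P'.al_s_dn_iff(2)[OF gy] crit sx by simp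
      ultimately show ?thesis unfolding hx using sx ga[OF y(1)] by (simp add: hdn)
    next
      case sx: False
      have up: "P.al (P.s x) \<in> P.dn" using sx P.al_dn_iff x by simp
      have "P.exc (P.al (P.s x)) y" using P.exc_up_up[OF y(1)] y(2) sx by simp
      then have "P'.exc (g (P.al (P.s x))) (g y)" using gexc up by blast
      moreover have ph: "P'.ph (g y) \<notin> P'.dn" using crit sx by simp
      moreover from this have "P'.exc (P'.al (P'.ph (g y))) (g y)" using P'.exc_up_up[OF gy] by blast
      moreover from ph have "P'.al (P'.ph (g y)) \<in> P'.dn" using P'.al_dn_iff gy by simp
      ultimately have "g (P.al (P.s x)) = P'.al (P'.ph (g y))"
        using P'.TH.excursion_left_unique gdn up by blast
      then have "P'.al (g (P.al (P.s x))) = P'.ph (g y)" using gy by simp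
      then show ?thesis unfolding hx using sx by (simp add: hup)
    qed
  qed
  obtain d where d: "d \<in> P.dn" "qroot Q = {d, P.al d}" "mroot (psi Q) = P.m d"
    using P.root_obtain lquad_labelled_quads(3)[OF assms(1)] by metis
  obtain d' where d': "d' \<in> P'.dn" "qroot Q' = {d', P'.al d'}" "mroot (psi Q') = P'.m d'"
    using P'.root_obtain lquad_labelled_quads(3)[OF assms(2)] by metis
  have "P'.m (g d) = P'.m d'" using g(2) gm[OF d(1)] unfolding d(3) d'(3) by simp
  then have "g d = d'" using P'.M.inj gdn d(1) d'(1) by blast
  then have "h ` qroot Q = qroot Q'"
    unfolding d(2) d'(2) using hal[of d] d(1) by (simp add: hdn)
  then show ?thesis
    unfolding lquad_iso_def using bij hal hs hlb by (intro exI[of _ h]) simp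
qed

section \<open>The inverse construction\<close>

text \<open>A relational form of \<open>next_in\<close> without \<open>LEAST\<close>, so that a walk
  along the rotation can be extended at its start, one step at a time.\<close>

definition first_hit :: "(nat \<Rightarrow> nat) \<Rightarrow> nat set \<Rightarrow> nat \<Rightarrow> nat \<Rightarrow> bool" where
  "first_hit f S c d \<longleftrightarrow> (\<exists>k>0. (f ^^ k) c = d \<and> d \<in> S \<and> (\<forall>i. 0 < i \<and> i < k \<longrightarrow> (f ^^ i) c \<notin> S))"

lemma first_hit_next_in: "first_hit f S c d \<Longrightarrow> next_in f S c = d"
  unfolding first_hit_def using next_in_eqI by metis

lemma first_hit_now: "f c \<in> S \<Longrightarrow> first_hit f S c (f c)"
  unfolding first_hit_def by (intro exI[of _ 1]) auto

lemma first_hit_later: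
  assumes "f c \<notin> S" "first_hit f S (f c) d"
  shows "first_hit f S c d"
proof -
  obtain k where k: "k > 0" "(f ^^ k) (f c) = d" "d \<in> S"
    "\<And>i. 0 < i \<Longrightarrow> i < k \<Longrightarrow> (f ^^ i) (f c) \<notin> S"
    using assms(2) unfolding first_hit_def by blast
  have "(f ^^ i) c \<notin> S" if i: "0 < i" "i < Suc k" for i
  proof -
    obtain j where j: "i = Suc j" using i gr0_implies_Suc by blast
    have "(f ^^ i) c = (f ^^ j) (f c)" unfolding j by (simp only: funpow_Suc_right comp_apply)
    then show ?thesis using k(4)[of j] assms(1) i j by (cases "j = 0") auto
  qed
  moreover have "(f ^^ Suc k) c = d" using k(2) by (simp only: funpow_Suc_right comp_apply)
  ultimately show ?thesis unfolding first_hit_def using k(3) by (intro exI[of _ "Suc k"]) simp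
qed

text \<open>Darts are natural numbers, so the disjoint sum of two copies of the darts is coded by
  parity.\<close>

definition lo :: "nat \<Rightarrow> nat" where "lo e = 2 * e"
definition hi :: "nat \<Rightarrow> nat" where "hi e = 2 * e + 1"

lemma lo_hi [simp]: "lo e = lo e' \<longleftrightarrow> e = e'" "hi e = hi e' \<longleftrightarrow> e = e'" "lo e \<noteq> hi e'" "hi e \<noteq> lo e'"
  "even (lo e)" "odd (hi e)" "lo e div 2 = e" "hi e div 2 = e" "Suc (lo e) = hi e" "hi e - Suc 0 = lo e"
  unfolding lo_def hi_def by presburger+

section \<open>Excursions in a labelled map\<close>

locale labelled_map =
  fixes M :: lmap
  assumes fin: "finite (mD M)" and ne: "mD M \<noteq> {}"
    and alpha: "\<And>d. d \<in> mD M \<Longrightarrow> malpha M d \<in> mD M \<and> malpha M d \<noteq> d \<and> malpha M (malpha M d) = d"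
    and sigma_bij: "bij_betw (msigma M) (mD M) (mD M)"
    and lab_sigma: "\<And>d. d \<in> mD M \<Longrightarrow> mlab M (msigma M d) = mlab M d"
    and lab_alpha: "\<And>d. d \<in> mD M \<Longrightarrow> \<bar>mlab M (malpha M d) - mlab M d\<bar> \<le> 1"
begin

abbreviation "D \<equiv> mD M"
abbreviation "a \<equiv> malpha M"
abbreviation "m \<equiv> msigma M"
abbreviation "l \<equiv> mlab M"
definition "th = a \<circ> m"
abbreviation "exc \<equiv> excursion th l"

sublocale S: finite_perm D m
  using fin sigma_bij by unfold_locales

lemma a_D [simp]: "d \<in> D \<Longrightarrow> a d \<in> D" and a_neq: "d \<in> D \<Longrightarrow> a d \<noteq> d"
  and a_a [simp]: "d \<in> D \<Longrightarrow> a (a d) = d"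
  using alpha by auto

declare S.in_D [simp] lab_sigma [simp]

sublocale A: finite_perm D a
  using fin by unfold_locales (auto intro!: bij_betw_byWitness[where f' = a])

sublocale TH: finite_perm D th
  unfolding th_def using fin bij_betw_trans[OF S.bij A.bij] by unfold_locales

declare TH.in_D [simp]

lemma lab_th: "x \<in> D \<Longrightarrow> \<bar>l (th x) - l x\<bar> \<le> 1"
  using lab_alpha[of "m x"] by (simp add: th_def)

lemma m_pred: assumes "c \<in> D" obtains p where "p \<in> D" "m p = c" "th p = a c" "l p = l c"
proof -
  obtain p where p: "p \<in> D" "m p = c" using S.surj assms by blast
  then show ?thesis using that[of p] lab_sigma[OF p(1)] by (simp add: th_def)
qed

text \<open>On the cycle of \<open>x\<close>, let \<open>f\<close> be the last dart before the
  return to \<open>x\<close> with label at most \<open>l x\<close>. Its label equals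
  \<open>l x\<close>: on a longer stretch because the next label exceeds \<open>l x\<close> and
  steps are at most one, on a single step because \<open>m f = a x\<close>, where the hypothesis on
  labels enters.\<close>

lemma excursion_to:
  assumes "x \<in> D" "l x \<le> l (a x)"
  obtains f where "f \<in> D" "exc f x"
proof -
  obtain n where n: "n > 0" "(th ^^ n) x = x" using TH.returns assms(1) by blast
  define J where "J = {j. j < n \<and> l ((th ^^ j) x) \<le> l x}"
  have "finite J" "0 \<in> J" using n(1) by (auto simp: J_def)
  define j where "j = Max J"
  have "j \<in> J" unfolding j_def using \<open>finite J\<close> \<open>0 \<in> J\<close> by (intro Max_in) auto
  then have j: "j < n" "l ((th ^^ j) x) \<le> l x" by (auto simp: J_def)
  have max: "i \<le> j" if "i \<in> J" for i unfolding j_def using \<open>finite J\<close> that by (rule Max_ge)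
  define f where "f = (th ^^ j) x"
  have f: "f \<in> D" "l f \<le> l x" unfolding f_def using TH.pow_in assms(1) j by auto
  have fx: "(th ^^ (n - j)) f = x" unfolding f_def using funpow_split[of j n th x] j n(2) by simp
  have above: "l x < l ((th ^^ i) f)" if "0 < i" "i < n - j" for i
  proof -
    have "\<not> i + j \<le> j" using that by simp
    then have "i + j \<notin> J" using max by blast
    moreover have "i + j < n" using that by simp
    ultimately have "l x < l ((th ^^ (i + j)) x)" by (simp add: J_def)
    then show ?thesis unfolding f_def by (simp add: funpow_add)
  qed
  have "l f = l x"
  proof (cases "n - j = 1")
    case True
    then have "a (m f) = x" using fx by (simp add: th_def)
    then have "m f = a x" using f(1) a_a[of "m f"] by simp
    then have "l f = l (a x)" using lab_sigma[OF f(1)] by simp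
    then show ?thesis using f(2) assms(2) by simp
  next
    case False
    then have "1 < n - j" using j(1) by simp
    then have "l x < l (th f)" using above[of 1] by simp
    then show ?thesis using lab_th[OF f(1)] f(2) by simp
  qed
  then have "exc f x" unfolding excursion_def using fx above j(1) by (intro exI[of _ "n - j"]) auto
  then show ?thesis using that f(1) by blast
qed

text \<open>The first return to a label at most \<open>l e\<close> arrives exactly at
  \<open>l e\<close>, as steps are at most one; \<open>w\<close> is the dart just before it.\<close>

lemma excursion_from:
  assumes "e \<in> D" "l (th e) = l e + 1"
  obtains w where "w \<in> D" "exc e (th w)" "l w = l e + 1"
proof -
  define P where "P k \<longleftrightarrow> 0 < k \<and> l ((th ^^ k) e) \<le> l e" for k
  define k where "k = (LEAST k. P k)"
  obtain n where "n > 0" "(th ^^ n) e = e" using TH.returns assms(1) by blast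
  then have "P n" by (simp add: P_def)
  then have "P k" unfolding k_def by (rule LeastI)
  have least: "l e < l ((th ^^ i) e)" if "0 < i" "i < k" for i
    using not_less_Least[of i P] that unfolding k_def P_def by auto
  have k: "0 < k" "l ((th ^^ k) e) \<le> l e" using \<open>P k\<close> by (auto simp: P_def)
  have "k \<noteq> 1" using k(2) assms(2) by auto
  then obtain i where i: "k = Suc i" "0 < i" using k(1) by (cases k) auto
  define w where "w = (th ^^ i) e"
  have w: "w \<in> D" "th w = (th ^^ k) e" unfolding w_def i(1) using TH.pow_in assms(1) by auto
  have "l e < l w" unfolding w_def using least[of i] i by simp
  then have lw: "l (th w) = l e" "l w = l e + 1" using lab_th[OF w(1)] k(2) unfolding w(2) by auto
  have "exc e (th w)"
    unfolding excursion_def using w(2) lw(1) least k(1) by (intro exI[of _ k]) auto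
  then show ?thesis using that w(1) lw(2) by blast
qed

text \<open>Iterating \<open>prv\<close> runs back along an orbit of \<open>th\<close> at constant
  label until the preceding dart has a smaller label. So the edge of \<open>lo e\<close> ends at the
  last earlier dart of label \<open>l e - 1\<close>, or, if there is none, at a new vertex shared by
  the lowest darts of the orbit: the usual successor rule inside a face.\<close>

definition "prv x = (SOME f. f \<in> D \<and> exc f x)"
definition "lst e = (SOME w. w \<in> D \<and> exc e (th w))"

lemma prv_eq:
  assumes "f \<in> D" "exc f x"
  shows "prv x = f"
  unfolding prv_def
proof (rule some_equality)
  show "g = f" if "g \<in> D \<and> exc g x" for g using TH.excursion_left_unique that assms by blast
qed (use assms in simp)

lemma lst_eq:
  assumes "w \<in> D" "exc e (th w)"
  shows "lst e = w"
  unfolding lst_def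
proof (rule some_equality)
  show "v = w" if "v \<in> D \<and> exc e (th v)" for v
    using excursion_right_unique[of th l e] TH.inj that assms by blast
qed (use assms in simp)

text \<open>The dart \<open>lo e\<close> descends from the vertex of \<open>e\<close>, and \<open>hi e\<close> is its reverse.  The rotation is
  forced by \<open>exc_up_up\<close> and \<open>exc_dn_up\<close>; \<open>lst\<close> and \<open>prv\<close> are meaningful only in the cases where the
  rotation uses them, since only then does an excursion exist.\<close>

definition quad :: lquad where
  "quad = \<lparr> qD = lo ` D \<union> hi ` D,
     qalpha = (\<lambda>x. if even x then Suc x else x - 1),
     qsigma = (\<lambda>x. let e = x div 2 in
        if even x then (if l (th e) = l e + 1 then hi (lst e) else lo (m e))
        else (if l (a e) = l e - 1 then lo (a e) else hi (prv e))),
     qlab = (\<lambda>x. if even x then l (x div 2) else l (x div 2) - 1),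
     qroot = (let e = (SOME e. e \<in> D \<and> m e = mroot M) in {lo e, hi e}) \<rparr>"

abbreviation "ph \<equiv> face_perm (qalpha quad) (qsigma quad)"

section \<open>Faces of the constructed quadrangulation\<close>

lemma quad_D: "qD quad = lo ` D \<union> hi ` D"
  by (simp add: quad_def)

lemma al_quad [simp]: "qalpha quad (lo e) = hi e" "qalpha quad (hi e) = lo e"
  by (simp_all add: quad_def)

lemma lab_quad [simp]: "qlab quad (lo e) = l e" "qlab quad (hi e) = l e - 1"
  by (simp_all add: quad_def)

lemma sigma_lo: "qsigma quad (lo e) = (if l (th e) = l e + 1 then hi (lst e) else lo (m e))"
  and sigma_hi: "qsigma quad (hi e) = (if l (a e) = l e - 1 then lo (a e) else hi (prv e))"
  by (simp_all add: quad_def Let_def)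

lemma ph_lo: "ph (lo e) = (if l (a e) = l e - 1 then lo (a e) else hi (prv e))"
  and ph_hi: "ph (hi e) = (if l (th e) = l e + 1 then hi (lst e) else lo (m e))"
  by (simp_all add: face_perm_def sigma_lo sigma_hi)

text \<open>Since \<open>th p = c\<close> at constant label, \<open>prv c\<close> is
  \<open>p\<close>. This is half of a confluent face; exchanging \<open>c\<close> and
  \<open>a c\<close> gives the other half.\<close>

lemma conf_face:
  assumes "c \<in> D" "l (a c) = l c" "p \<in> D" "m p = a c"
  shows "ph (lo c) = hi p" "ph (hi p) = lo (a c)"
proof -
  have p: "th p = c" "l p = l c" using assms lab_sigma[OF assms(3)] by (simp_all add: th_def)
  have "exc p c" unfolding excursion_def using p by (intro exI[of _ 1]) auto
  then have "prv c = p" using prv_eq assms(3) by blast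
  then show "ph (lo c) = hi p" using assms(2) by (simp add: ph_lo)
  show "ph (hi p) = lo (a c)" using p assms(4) by (simp add: ph_hi)
qed

text \<open>Because \<open>th p = a c\<close>, the excursion from \<open>q = prv (a c)\<close> to
  \<open>a c\<close> has \<open>p\<close> as its last inner dart, so \<open>lst q = p\<close>. It
  has more than one step, since \<open>p\<close> lies one label above \<open>q\<close>.\<close>

lemma top_face:
  assumes "c \<in> D" "l (a c) = l c - 1" "p \<in> D" "m p = c"
  shows "ph (lo c) = lo (a c)" "ph (lo (a c)) = hi (prv (a c))" "ph (hi (prv (a c))) = hi p" "ph (hi p) = lo c"
    "prv (a c) \<in> D"
proof -
  show "ph (lo c) = lo (a c)" using assms(2) by (simp add: ph_lo)
  show "ph (lo (a c)) = hi (prv (a c))" using assms(1,2) by (simp add: ph_lo)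
  have p: "th p = a c" "l p = l c" using assms lab_sigma[OF assms(3)] by (simp_all add: th_def)
  show "ph (hi p) = lo c" using p assms(2,4) by (simp add: ph_hi)
  obtain q where q: "q \<in> D" "exc q (a c)" using excursion_to[of "a c"] assms(1,2) by auto
  have prv: "prv (a c) = q" using prv_eq q by blast
  then show "prv (a c) \<in> D" using q(1) by simp
  obtain n where n: "n > 0" "(th ^^ n) q = a c" "l (a c) = l q" "\<And>i. 0 < i \<Longrightarrow> i < n \<Longrightarrow> l q < l ((th ^^ i) q)"
    using q(2) unfolding excursion_def by blast
  have "n \<noteq> 1"
  proof
    assume "n = 1"
    then have "th q = th p" using n(2) p(1) by simp
    then have "q = p" using TH.inj q(1) assms(3) by blast
    then show False using n(3) p(2) assms(2) by simp
  qed
  then have "1 < n" using n(1) by simp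
  then have "l q < l (th q)" using n(4)[of 1] by simp
  then have "l (th q) = l q + 1" using lab_th[OF q(1)] by simp
  moreover have "lst q = p" using lst_eq[OF assms(3)] q(2) p(1) by simp
  ultimately show "ph (hi (prv (a c))) = hi p" unfolding prv by (simp add: ph_hi)
qed

text \<open>The criterion of \<open>card_orbit_4_iff\<close> together with closure:
  \<open>ph\<close> is not yet known to be a permutation, and the fourth-power identity is what
  later supplies its inverse.\<close>

definition "quad_face x \<longleftrightarrow> ph x \<in> qD quad \<and> ph (ph (ph (ph x))) = x \<and> ph (ph x) \<noteq> x"

lemma quad_faceI:
  assumes "ph w = x" "ph x = y" "ph y = z" "ph z = w" "w \<noteq> y" "x \<noteq> z"
    "w \<in> qD quad" "x \<in> qD quad" "y \<in> qD quad" "z \<in> qD quad"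
  shows "quad_face w" "quad_face x" "quad_face y" "quad_face z"
  using assms unfolding quad_face_def by simp_all

lemma conf_quad:
  assumes "c \<in> D" "l (a c) = l c" "p \<in> D" "m p = a c"
  shows "quad_face (lo c)" "quad_face (hi p)"
proof -
  obtain r where r: "r \<in> D" "m r = c" by (rule m_pred[OF assms(1)])
  have ac: "a c \<in> D" "l (a (a c)) = l (a c)" "m r = a (a c)" using assms r by simp_all
  have "p \<noteq> r" using r assms(4) a_neq[OF assms(1)] by auto
  note f = conf_face[OF assms] conf_face[OF ac(1,2) r(1) ac(3)]
  have "ph (hi r) = lo c" using f(4) assms(1) by simp
  then show "quad_face (lo c)" "quad_face (hi p)"
    using quad_faceI[of "lo c" "hi p" "lo (a c)" "hi r"] f(1-3) \<open>p \<noteq> r\<close> assms ac(1) r(1) a_neq[OF assms(1)]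
    unfolding quad_D by auto
qed

lemma top_quad:
  assumes "c \<in> D" "l (a c) = l c - 1" "p \<in> D" "m p = c"
  shows "quad_face (lo c)" "quad_face (lo (a c))" "quad_face (hi (prv (a c)))" "quad_face (hi p)"
  using quad_faceI[OF top_face(1-4)[OF assms]] top_face(5)[OF assms] assms unfolding quad_D by auto

lemma all_quad:
  assumes "x \<in> qD quad"
  shows "quad_face x"
proof -
  consider (lo) c where "c \<in> D" "x = lo c" | (hi) e where "e \<in> D" "x = hi e"
    using assms unfolding quad_D by blast
  then show ?thesis
  proof cases
    case lo
    obtain p where p: "p \<in> D" "m p = a c" by (rule m_pred[OF a_D[OF lo(1)]])
    obtain r where r: "r \<in> D" "m r = c" by (rule m_pred[OF lo(1)])
    consider "l (a c) = l c" | "l (a c) = l c - 1" | "l (a c) = l c + 1"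
      using lab_alpha[OF lo(1)] by linarith
    then show ?thesis
    proof cases
      case 1
      then show ?thesis using conf_quad(1)[OF lo(1) _ p] lo(2) by simp
    next
      case 2
      then show ?thesis using top_quad(1)[OF lo(1) _ r] lo(2) by simp
    next
      case 3
      then show ?thesis using top_quad(2)[OF a_D[OF lo(1)] _ p] lo by simp
    qed
  next
    case hi
    have c: "m e \<in> D" "l (m e) = l e" "th e = a (m e)" using hi(1) by (simp_all add: th_def)
    consider "l (a (m e)) = l (m e)" | "l (a (m e)) = l (m e) - 1" | "l (a (m e)) = l (m e) + 1"
      using lab_alpha[OF c(1)] by linarith
    then show ?thesis
    proof cases
      case 1
      then show ?thesis using conf_quad(2)[OF a_D[OF c(1)] _ hi(1)] c(1) hi(2) by simp
    next
      case 2
      then show ?thesis using top_quad(4)[OF c(1) _ hi(1)] hi(2) by simp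
    next
      case 3
      \<comment> \<open>The dart \<open>hi e\<close> is the third corner of the simple face with top
        \<open>m w\<close>, because \<open>prv (th w) = e\<close>.\<close>
      then obtain w where w: "w \<in> D" "exc e (th w)" "l w = l e + 1"
        using excursion_from[OF hi(1)] c by auto
      have aw: "a (m w) = th w" by (simp add: th_def)
      have "l (th w) = l e" using w(2) unfolding excursion_def by blast
      then have "quad_face (hi (prv (a (m w))))"
        using top_quad(3)[OF S.in_D[OF w(1)] _ w(1)] w aw by simp
      then show ?thesis using prv_eq[OF hi(1) w(2)] hi(2) aw by simp
    qed
  qed
qed

lemma al_quad_D: "x \<in> qD quad \<Longrightarrow> qalpha quad x \<in> qD quad" "x \<in> qD quad \<Longrightarrow> qalpha quad x \<noteq> x"
  "x \<in> qD quad \<Longrightarrow> qalpha quad (qalpha quad x) = x"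
  unfolding quad_D by auto

lemma sigma_ph: "x \<in> qD quad \<Longrightarrow> qsigma quad x = ph (qalpha quad x)"
  using al_quad_D(3) by (simp add: face_perm_def)

lemma fin_quad: "finite (qD quad)"
  unfolding quad_D using fin by simp

lemma bij_ph: "bij_betw ph (qD quad) (qD quad)"
  by (rule bij_betw_byWitness[where f' = "ph \<circ> ph \<circ> ph"])
    (use all_quad in \<open>auto simp: quad_face_def\<close>)

lemma lab_sigma_quad: assumes "x \<in> qD quad" shows "qlab quad (qsigma quad x) = qlab quad x"
proof -
  consider (lo) e where "e \<in> D" "x = lo e" | (hi) e where "e \<in> D" "x = hi e"
    using assms unfolding quad_D by blast
  then show ?thesis
  proof cases
    case lo
    show ?thesis
    proof (cases "l (th e) = l e + 1")
      case True
      obtain w where "w \<in> D" "exc e (th w)" "l w = l e + 1" by (rule excursion_from[OF lo(1) True])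
      then show ?thesis using True lst_eq lo(2) by (simp add: sigma_lo)
    next
      case False
      then show ?thesis using lo by (simp add: sigma_lo)
    qed
  next
    case hi
    show ?thesis
    proof (cases "l (a e) = l e - 1")
      case True
      then show ?thesis using hi by (simp add: sigma_hi)
    next
      case False
      then have "l e \<le> l (a e)" using lab_alpha[OF hi(1)] by simp
      then obtain f where f: "f \<in> D" "exc f e" using excursion_to hi(1) by blast
      then have "l f = l e" unfolding excursion_def by metis
      then show ?thesis using False hi(2) prv_eq[OF f] by (simp add: sigma_hi)
    qed
  qed
qed

lemma bij_sigma_quad: "bij_betw (qsigma quad) (qD quad) (qD quad)"
proof -
  have "bij_betw (qalpha quad) (qD quad) (qD quad)"
    by (rule bij_betw_byWitness[where f' = "qalpha quad"]) (use al_quad_D in auto)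
  then have "bij_betw (ph \<circ> qalpha quad) (qD quad) (qD quad)" using bij_ph by (rule bij_betw_trans)
  then show ?thesis by (subst bij_betw_cong[of _ _ "ph \<circ> qalpha quad"]) (simp_all add: sigma_ph)
qed

sublocale Q: labelled_quads quad
proof
  show "finite (qD quad)" by (rule fin_quad)
  show "qD quad \<noteq> {}" using ne by (simp add: quad_D)
  show "qalpha quad d \<in> qD quad \<and> qalpha quad d \<noteq> d \<and> qalpha quad (qalpha quad d) = d"
    if "d \<in> qD quad" for d using al_quad_D that by simp
  show "bij_betw (qsigma quad) (qD quad) (qD quad)" by (rule bij_sigma_quad)
  interpret PH: finite_perm "qD quad" ph using fin_quad bij_ph by unfold_locales
  show "card (f_orbit ph d) = 4" if "d \<in> qD quad" for d
    using PH.card_orbit_4_iff[OF that] all_quad[OF that] by (simp add: quad_face_def)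
  show "qlab quad (qsigma quad d) = qlab quad d" if "d \<in> qD quad" for d using lab_sigma_quad that .
  show "\<bar>qlab quad (qalpha quad d) - qlab quad d\<bar> = 1" if "d \<in> qD quad" for d
    using that unfolding quad_D by auto
qed

section \<open>The map of the constructed quadrangulation\<close>

lemma dn_quad: "Q.dn = lo ` D"
  unfolding Q.dn_def quad_D by auto

lemma a_quad:
  assumes "c \<in> D"
  shows "Q.a (lo c) = lo (a c)"
proof -
  have top: "Q.a (lo c) = lo (a c)" if c: "c \<in> D" "l (a c) = l c - 1" for c
  proof -
    obtain p where p: "p \<in> D" "m p = c" by (rule m_pred[OF c(1)])
    note f = top_face[OF c p]
    obtain q where "q \<in> D" "exc q (a c)" using excursion_to[of "a c"] c by auto
    then have "l (prv (a c)) = l (a c)" using prv_eq unfolding excursion_def by auto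
    then have "Q.a (lo c) = ph (lo c)"
      using c by (intro Q.a_top) (simp_all add: dn_quad f(1,2))
    then show ?thesis using f(1) by simp
  qed
  obtain p where p: "p \<in> D" "m p = a c" "l p = l (a c)" by (rule m_pred[OF a_D[OF assms]])
  obtain r where r: "r \<in> D" "m r = c" "l r = l c" by (rule m_pred[OF assms])
  consider "l (a c) = l c" | "l (a c) = l c - 1" | "l (a c) = l c + 1"
    using lab_alpha[OF assms] by linarith
  then show ?thesis
  proof cases
    case 1
    have ac: "a c \<in> D" "l (a (a c)) = l (a c)" "m r = a (a c)" using assms r 1 by simp_all
    note f = conf_face[OF assms 1 p(1,2)] conf_face[OF ac(1,2) r(1) ac(3)]
    have "Q.a (lo c) = ph (ph (lo c))"
      using assms 1 r(3) by (intro Q.a_conf) (simp_all add: dn_quad f(1-3))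
    then show ?thesis using f by simp
  next
    case 2
    then show ?thesis using top assms by blast
  next
    case 3
    then have "Q.a (lo (a c)) = lo c" using top[of "a c"] assms by simp
    moreover have "lo (a c) \<in> Q.dn" using assms by (simp add: dn_quad)
    ultimately show ?thesis using Q.a_a[of "lo (a c)"] by simp
  qed
qed

text \<open>From \<open>hi x\<close> the rotation goes back through the excursion by
  \<open>prv\<close>, always at label \<open>l e + 1\<close>, until the dart before on the orbit has
  label \<open>l e\<close>. That dart can only be \<open>e\<close>, and the rotation then reaches
  \<open>lo (m e)\<close>.\<close>

lemma excursion_hits:
  assumes e: "e \<in> D"
  shows "0 < j \<Longrightarrow> (\<And>i. 0 < i \<Longrightarrow> i \<le> j \<Longrightarrow> l e < l ((th ^^ i) e)) \<Longrightarrow> l ((th ^^ j) e) = l e + 1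
    \<Longrightarrow> first_hit (qsigma quad) Q.dn (hi ((th ^^ j) e)) (lo (m e))"
proof (induction j rule: less_induct)
  case (less j)
  define x where "x = (th ^^ j) e"
  have x: "x \<in> D" "l x = l e + 1" unfolding x_def using TH.pow_in e less.prems(3) by auto
  obtain i where i: "j = Suc i" using less.prems(1) by (cases j) auto
  define y where "y = (th ^^ i) e"
  have y: "y \<in> D" "th y = x" unfolding y_def x_def i using TH.pow_in e by auto
  then have my: "m y = a x" using a_a[of "m y"] by (simp add: th_def)
  have ly: "l y = l (a x)" using lab_sigma[OF y(1)] my by simp
  show ?case
  proof (cases "l (a x) = l x - 1")
    case True
    have "i = 0"
    proof (rule ccontr)
      assume "i \<noteq> 0"
      then have "l e < l y" unfolding y_def using less.prems(2)[of i] i by simp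
      then show False using True ly x(2) by simp
    qed
    then have "y = e" by (simp add: y_def)
    then have "qsigma quad (hi x) = lo (m e)" using True my by (simp add: sigma_hi)
    then show ?thesis using first_hit_now[of "qsigma quad" "hi x" Q.dn] e
      unfolding x_def[symmetric] by (simp add: dn_quad)
  next
    case False
    then have "l x \<le> l (a x)" using lab_alpha[OF x(1)] by simp
    then obtain f where f: "f \<in> D" "exc f x" using excursion_to x(1) by blast
    obtain n where n: "n > 0" "(th ^^ n) f = x" "l x = l f" "\<And>i. 0 < i \<Longrightarrow> i < n \<Longrightarrow> l f < l ((th ^^ i) f)"
      using f(2) unfolding excursion_def by blast
    \<comment> \<open>Otherwise \<open>e\<close> would be the start of the excursion from
      \<open>f\<close> or lie inside it, and so have label at least
      \<open>l f = l e + 1\<close>.\<close>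
    have "n < j"
    proof (rule ccontr)
      assume "\<not> n < j"
      then have jn: "j \<le> n" by simp
      then have e': "e = (th ^^ (n - j)) f"
        using TH.pow_cancel[OF e f(1) _ jn] n(2) by (simp add: x_def)
      show False
      proof (cases "n = j")
        case True
        then show False using e' n(3) x(2) by simp
      next
        case False
        then have "0 < n - j" "n - j < n" using jn less.prems(1) by auto
        then have "l f < l e" using n(4) e' by metis
        then show False using n(3) x(2) by simp
      qed
    qed
    have "f = (th ^^ (j - n)) e"
      using TH.pow_cancel[OF f(1) e, of n j] n(2) \<open>n < j\<close> by (simp add: x_def)
    moreover have "first_hit (qsigma quad) Q.dn (hi ((th ^^ (j - n)) e)) (lo (m e))"
    proof (rule less.IH)
      show "j - n < j" "0 < j - n" using n(1) \<open>n < j\<close> by auto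
      show "l e < l ((th ^^ i) e)" if "0 < i" "i \<le> j - n" for i using less.prems(2)[of i] that by simp
      show "l ((th ^^ (j - n)) e) = l e + 1" using \<open>f = (th ^^ (j - n)) e\<close> n(3) x(2) by simp
    qed
    ultimately have "first_hit (qsigma quad) Q.dn (hi f) (lo (m e))" by simp
    moreover have "qsigma quad (hi x) = hi f" using False prv_eq[OF f] by (simp add: sigma_hi)
    moreover have "hi f \<notin> Q.dn" by (auto simp: dn_quad)
    ultimately show ?thesis
      using first_hit_later[of "qsigma quad" "hi x" Q.dn] unfolding x_def[symmetric] by simp
  qed
qed

lemma m_quad:
  assumes e: "e \<in> D"
  shows "Q.m (lo e) = lo (m e)"
proof (cases "l (th e) = l e + 1")
  case True
  obtain w where w: "w \<in> D" "exc e (th w)" "l w = l e + 1" by (rule excursion_from[OF e True])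
  obtain n where n: "n > 0" "(th ^^ n) e = th w" "l (th w) = l e" "\<And>i. 0 < i \<Longrightarrow> i < n \<Longrightarrow> l e < l ((th ^^ i) e)"
    using w(2) unfolding excursion_def by blast
  have "n \<noteq> 1" using n(2,3) True by auto
  then obtain j where j: "n = Suc j" "0 < j" using n(1) by (cases n) auto
  have wj: "w = (th ^^ j) e" using n(2) TH.inj[OF w(1) TH.pow_in[OF e]] unfolding j(1) by simp
  have "first_hit (qsigma quad) Q.dn (hi w) (lo (m e))"
    unfolding wj using excursion_hits[OF e j(2)] n(4) j(1) w(3) wj by simp
  moreover have "qsigma quad (lo e) = hi w" using True lst_eq[OF w(1,2)] by (simp add: sigma_lo)
  moreover have "hi w \<notin> Q.dn" by (auto simp: dn_quad)
  ultimately have "first_hit (qsigma quad) Q.dn (lo e) (lo (m e))"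
    using first_hit_later[of "qsigma quad" "lo e" Q.dn] by simp
  then show ?thesis by (rule first_hit_next_in)
next
  case False
  then have "qsigma quad (lo e) = lo (m e)" by (simp add: sigma_lo)
  then show ?thesis using next_in_step[of "qsigma quad" "lo e" Q.dn] e by (simp add: dn_quad)
qed

text \<open>Counts and connectedness pass along \<open>lo\<close> to the map of \<open>quad\<close>;
  \<open>planar_psi\<close>, read from the map to the quadrangulation, then brings planarity
  back.\<close>

lemma planar_quad:
  assumes "is_planar_map D a m"
  shows "is_planar_map (qD quad) (qalpha quad) (qsigma quad)"
proof -
  have lo: "inj_on lo D" "lo ` D = Q.dn" by (simp_all add: inj_on_def dn_quad)
  have v: "n_vertices Q.dn Q.a Q.m = n_vertices D a m"
    unfolding n_vertices_def by (rule card_f_orbits_transport[OF lo]) (simp_all add: m_quad)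
  have e: "n_edges Q.dn Q.a Q.m = n_edges D a m"
    unfolding n_edges_def by (rule card_f_orbits_transport[OF lo]) (simp_all add: a_quad)
  have f: "n_faces Q.dn Q.a Q.m = n_faces D a m"
    unfolding n_faces_def by (rule card_f_orbits_transport[OF lo]) (simp_all add: a_quad m_quad face_perm_def)
  let ?R = "{(d, a d) | d. d \<in> D} \<union> {(d, m d) | d. d \<in> D}"
  let ?R' = "{(d, Q.a d) | d. d \<in> Q.dn} \<union> {(d, Q.m d) | d. d \<in> Q.dn}"
  have step: "(lo x, lo y) \<in> ?R'" if "(x, y) \<in> ?R" for x y
    using that a_quad m_quad unfolding dn_quad by force
  have path: "(lo x, lo y) \<in> ?R'\<^sup>*" if "(x, y) \<in> ?R\<^sup>*" for x y
    using that
  proof (induction rule: rtrancl_induct)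
    case (step y z)
    show ?case using step.IH \<open>(y, z) \<in> ?R\<close>[THEN \<open>\<And>x y. (x, y) \<in> ?R \<Longrightarrow> (lo x, lo y) \<in> ?R'\<close>]
      by (rule rtrancl_into_rtrancl)
  qed simp
  have "\<forall>x\<in>D. \<forall>y\<in>D. (x, y) \<in> ?R\<^sup>*" using assms unfolding is_planar_map_def by blast
  then have "\<forall>x\<in>D. \<forall>y\<in>D. (lo x, lo y) \<in> ?R'\<^sup>*" using path by simp
  then have conn: "\<forall>x\<in>Q.dn. \<forall>y\<in>Q.dn. (x, y) \<in> ?R'\<^sup>*"
    unfolding lo(2)[symmetric] ball_simps(9) .
  have inv: "\<forall>d\<in>Q.dn. Q.a d \<in> Q.dn \<and> Q.a d \<noteq> d \<and> Q.a (Q.a d) = d" using Q.a_neq by simp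
  have euler: "int (n_vertices Q.dn Q.a Q.m) - int (n_edges Q.dn Q.a Q.m) + int (n_faces Q.dn Q.a Q.m) = 2"
    using assms unfolding is_planar_map_def v e f by blast
  have "is_planar_map Q.dn Q.a Q.m"
    unfolding is_planar_map_def using Q.M.fin Q.dn_ne inv Q.M.bij conn euler by blast
  then show ?thesis using Q.planar_psi by simp
qed

end

lemma psi_surj:
  assumes "is_lmap M"
  shows "\<exists>Q. is_lquad Q \<and> lmap_iso (psi Q) M"
proof -
  interpret labelled_map M
    using assms unfolding is_lmap_def is_planar_map_def by unfold_locales auto
  have pl: "is_planar_map D a m" and root: "mroot M \<in> D" using assms by (auto simp: is_lmap_def)
  \<comment> \<open>The root corner of \<open>psi\<close> is \<open>m d\<close> for the descending
    root dart \<open>d\<close>, so the root edge must come from the \<open>m\<close>-predecessor of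
    the given root.\<close>
  obtain e where e: "e \<in> D" "m e = mroot M" by (rule m_pred[OF root])
  have "(SOME e. e \<in> D \<and> m e = mroot M) = e"
    using e S.inj by (intro some_equality) auto
  then have qr: "qroot quad = {lo e, hi e}" by (simp add: quad_def)
  then have lq: "is_lquad quad"
    unfolding is_lquad_def is_quadrangulation_def
    using planar_quad[OF pl] Q.face4 Q.lab_sigma Q.lab_alpha e(1)
    by (auto simp: quad_D)
  obtain d where d: "d \<in> Q.dn" "qroot quad = {d, qalpha quad d}" "mroot (psi quad) = Q.m d"
    using Q.root_obtain[of "lo e"] qr e(1) by (auto simp: quad_D)
  have "d \<in> {lo e, hi e}" using d(2) qr by auto
  then have "d = lo e" using d(1) by (auto simp: dn_quad)
  then have r: "mroot (psi quad) = lo (mroot M)" using d(3) m_quad[OF e(1)] e(2) by simp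
  have "lmap_iso (psi quad) M"
    unfolding lmap_iso_def
  proof (intro exI[of _ "\<lambda>x. x div 2"] conjI ballI)
    show "bij_betw (\<lambda>x. x div 2) (mD (psi quad)) (mD M)"
      by (rule bij_betw_byWitness[where f' = lo]) (auto simp: dn_quad)
  qed (use r in \<open>auto simp: dn_quad a_quad m_quad[unfolded dn_quad]\<close>)
  then show ?thesis using lq by blast
qed

theorem theorem1:
  shows "(\<forall>Q. is_lquad Q \<longrightarrow> is_lmap (psi Q)) \<and>
   (\<forall>Q Q'. is_lquad Q \<and> is_lquad Q' \<and> lquad_iso Q Q' \<longrightarrow> lmap_iso (psi Q) (psi Q')) \<and>
   (\<forall>Q Q'. is_lquad Q \<and> is_lquad Q' \<and> lmap_iso (psi Q) (psi Q') \<longrightarrow> lquad_iso Q Q') \<and>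
   (\<forall>M. is_lmap M \<longrightarrow> (\<exists>Q. is_lquad Q \<and> lmap_iso (psi Q) M)) \<and>
   (\<forall>Q. is_lquad Q \<longrightarrow>
      n_edges (mD (psi Q)) (malpha (psi Q)) (msigma (psi Q)) = n_faces (qD Q) (qalpha Q) (qsigma Q) \<and>
      n_faces (mD (psi Q)) (malpha (psi Q)) (msigma (psi Q))
        = card (local_mins (qD Q) (qalpha Q) (qsigma Q) (qlab Q)) \<and>
      card (local_maxs (mD (psi Q)) (malpha (psi Q)) (msigma (psi Q)) (mlab (psi Q)))
        = card (local_maxs (qD Q) (qalpha Q) (qsigma Q) (qlab Q)) \<and>
      local_maxs (qD Q) (qalpha Q) (qsigma Q) (qlab Q)
        = {f_orbit (qsigma Q) d | d. d \<in> mD (psi Q) \<and>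
             f_orbit (msigma (psi Q)) d \<in> local_maxs (mD (psi Q)) (malpha (psi Q)) (msigma (psi Q)) (mlab (psi Q))} \<and>
      Max (mlab (psi Q) ` mD (psi Q)) = Max (qlab Q ` qD Q) \<and>
      Min (mlab (psi Q) ` mD (psi Q)) = Min (qlab Q ` qD Q) + 1 \<and>
      mlab (psi Q) (mroot (psi Q)) = Max (qlab Q ` qroot Q))"
proof (intro conjI allI impI; (elim conjE)?)
  fix Q assume Q: "is_lquad Q"
  interpret labelled_quads Q using lquad_labelled_quads Q by blast
  obtain d where d: "d \<in> dn" "qroot Q = {d, al d}" "mroot (psi Q) = m d"
    using root_obtain lquad_labelled_quads(3)[OF Q] by metis
  show "is_lmap (psi Q)" using is_lmap_psi Q .
  show "n_edges (mD (psi Q)) (malpha (psi Q)) (msigma (psi Q)) = n_faces D al s"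
    using n_edges_psi_faces by simp
  show "n_faces (mD (psi Q)) (malpha (psi Q)) (msigma (psi Q)) = card (local_mins D al s lb)"
    using n_faces_psi by simp
  show "card (local_maxs (mD (psi Q)) (malpha (psi Q)) (msigma (psi Q)) (mlab (psi Q)))
      = card (local_maxs D al s lb)"
    using local_maxs_psi by simp
  show "local_maxs D al s lb
      = {f_orbit s d | d. d \<in> mD (psi Q) \<and>
           f_orbit (msigma (psi Q)) d \<in> local_maxs (mD (psi Q)) (malpha (psi Q)) (msigma (psi Q)) (mlab (psi Q))}"
    unfolding psi_sel by (rule local_maxs_orbits)
  show "Max (mlab (psi Q) ` mD (psi Q)) = Max (lb ` D)" using Max_lab_psi by simp
  show "Min (mlab (psi Q) ` mD (psi Q)) = Min (lb ` D) + 1" using Min_lab_psi by simp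
  show "mlab (psi Q) (mroot (psi Q)) = Max (lb ` qroot Q)"
    unfolding d(2,3) using d(1) lab_al_dn[OF d(1)] by simp
qed (use psi_respects_iso psi_reflects_iso psi_surj in blast)+

end
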